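(* Let $\alpha\in[0,\infty]$, $x\in\mathbb R$ and $X\in\mathcal X_\alpha$. The following properties of the tail probability bounds $P_\alpha(X;x)$ are valid. 1. (Model-independence) $P_\alpha(X;x)$ depends on the random variable $X$ only through the distribution of $X$. 2. (Monotonicity in $X$) $P_\alpha(\cdot\,;x)$ is nondecreasing with respect to the stochastic dominance of order $\alpha+1$: for any random variable $Y$ such that $X\overset{\alpha+1}{\le}Y$, one has $P_\alpha(X;x)\le P_\alpha(Y;x)$. Therefore, $P_\alpha(\cdot\,;x)$ is nondecreasing with respect to the stochastic dominance of any order $\gamma\in[1,\alpha+1]$; in particular, for any random variable $Y$ such that $X\le Y$, one has $P_\alpha(X;x)\le P_\alpha(Y;x)$. 3. (Monotonicity in $\alpha$) $P_\alpha(X;x)$ is nondecreasing in $\alpha\in[0,\infty]$. 4. (Monotonicity in $x$) $P_\alpha(X;x)$ is nonincreasing in $x\in\mathbb R$. 5. (Values) $P_\alpha(X;x)$ takes only values in the interval $[0,1]$. 6. ($\alpha$-concavity in $x$) $P_\alpha(X;x)^{-1/\alpha}$ is convex in $x$ if $\alpha\in(0,\infty)$, and $\ln P_\alpha(X;x)$ is concave in $x$ if $\alpha=\infty$. 7. (Stability in $x$) $P_\alpha(X;x)$ is continuous in $x$ at any point $x\in\mathbb R$, except the point $x=x_*$ when $p_*>0$. 8. (Stability in $\alpha$) Suppose that $(\alpha_n)$ is any sequence in $[0,\infty)$ converging to $\alpha\in[0,\infty]$, with $\beta:=\sup_n\alpha_n$ and $X\in\mathcal X_\beta$. Then $P_{\alpha_n}(X;x)\to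 P_\alpha(X;x)$. 9. (Stability in $X$) Suppose that $\alpha\in(0,\infty]$ and that $(X_n)_{n\in\mathbb N}$ is a sequence of real-valued random variables such that $X_n\to X$ in distribution as $n\to\infty$ and the following uniform integrability condition holds: $\sup_n\mathsf E(X_n)_+^\alpha\,\mathsf I\{X_n>N\}\to0$ as $N\to\infty$ if $\alpha\in(0,\infty)$; $\sup_n\mathsf E e^{\lambda X_n}\,\mathsf I\{X_n>N\}\to0$ as $N\to\infty$ for each $\lambda\in\Lambda_X$ if $\alpha=\infty$. Then $P_\alpha(X_n;x)\to P_\alpha(X;x)$. 10. (Translation invariance) $P_\alpha(X+c;x+c)=P_\alpha(X;x)$ for all real $c$. 11. (Consistency) $P_\alpha(c;x)=P_0(c;x)=\mathsf I\{c\ge x\}$ for all real $c$; that is, if the random variable $X$ is the constant $c$, then all the tail probability bounds $P_\alpha(X;x)$ precisely equal the true tail probability $\mathsf P(X\ge x)$. 12. (Positive homogeneity) $P_\alpha(\kappa X;\kappa x)=P_\alpha(X;x)$ for all real $\kappa>0$.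
   Context: For real $u$, $u_+:=\max(0,u)$ and $u_+^\alpha:=(u_+)^\alpha$; $\mathsf I\{\cdot\}$ is the indicator. Define $h_\alpha:\mathbb R\to\mathbb R$ by $h_0(u)=\mathsf I\{u\ge0\}$, $h_\alpha(u)=(1+u/\alpha)_+^\alpha$ for $0<\alpha<\infty$, and $h_\infty(u)=e^u$. For a random variable $X$, $x\in\mathbb R$ and $\alpha\in[0,\infty]$ put $P_\alpha(X;x):=\inf_{\lambda\in(0,\infty)}\mathsf E\,h_\alpha(\lambda(X-x))$; in particular $P_0(X;x)=\mathsf P(X\ge x)$. $\mathcal X_0$ is the set of all real-valued random variables on a given probability space; for $\alpha\in(0,\infty)$, $\mathcal X_\alpha$ is the set of those $X$ with $\mathsf E X_+^\alpha<\infty$; $\Lambda_X:=\{\lambda\in(0,\infty):\mathsf E e^{\lambda X}<\infty\}$, and $\mathcal X_\infty$ is the set of those $X$ with $\Lambda_X\neq\emptyset$. By standing convention, an expression $P_\alpha(Z;\cdot)$ is considered only for random variables $Z\in\mathcal X_\alpha$. $x_*:=\sup\operatorname{supp}X\in(-\infty,\infty]$, where $\operatorname{supp}X$ is the support of the distribution of $X$, and $p_*:=\mathsf P(X=x_* )$. Stochastic dominance: let $T_\alpha:=\mathbb R$ for $\alpha\in[0,\infty)$ and $T_\infty:=(0,\infty)$; let $g_{0;t}(u):=\mathsf I\{u>t\}$, $g_{\alpha;t}(u):=(u-t)_+^\alpha$ for $\alpha\in(0,\infty)$, $g_{\infty;t}(u):=e^{u/t}$. Let $\mathcal H^\alpha$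 be the set of functions $g:\mathbb R\to\mathbb R$ of the form $g(u)=\int_{T_\alpha}g_{\alpha;t}(u)\,\mu(dt)$ for all $u\in\mathbb R$, where $\mu$ is a nonnegative Borel measure on $T_\alpha$. For random variables $X,Y$, $X\overset{\alpha+1}{\le}Y$ (stochastic dominance of order $\alpha+1$) means $\mathsf E g(X)\le\mathsf E g(Y)$ for all $g\in\mathcal H^\alpha$ (equivalently, $\mathsf E g_{\alpha;t}(X)\le\mathsf E g_{\alpha;t}(Y)$ for all $t\in T_\alpha$). Here $\infty+1:=\infty$. Conventions: $0^{-a}:=\infty$ for real $a>0$ and $\ln0:=-\infty$.
   Formalization: Stability in x (item 7) is stated only for α in (0,∞], since for α=0 P(X≥x) jumps at every atom of X; stability in X (item 9) excludes the point x=x_* when p_*>0, where X_n=x−1/(n+1), X=x is a counterexample. *)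

theory Defs
  imports "HOL-Probability.Probability"
begin

text \<open>
  The parameter \<open>\<alpha> \<in> [0,\<infinity>]\<close> is an \<^typ>\<open>ennreal\<close>. All expectations occurring below are of
  nonnegative functions and may be infinite, so they are taken as nonnegative Lebesgue integrals
  with values in \<^typ>\<open>ennreal\<close>. A random variable is given together with its probability
  space, so that random variables on different spaces can be compared.
\<close>

definition tail_h :: "ennreal \<Rightarrow> real \<Rightarrow> real" where
  "tail_h \<alpha> u =
     (if \<alpha> = 0 then (if u \<ge> 0 then 1 else 0)
      else if \<alpha> = \<infinity> then exp u
      else (max 0 (1 + u / enn2real \<alpha>)) powr enn2real \<alpha>)"

definition tail_bound :: "ennreal \<Rightarrow> 'a measure \<Rightarrow> ('a \<Rightarrow> real) \<Rightarrow> real \<Rightarrow> ennreal" where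
  "tail_bound \<alpha> M X x =
     (INF l\<in>{0<..}. \<integral>\<^sup>+ \<omega>. ennreal (tail_h \<alpha> (l * (X \<omega> - x))) \<partial>M)"

lemma tail_bound_0:
  assumes "X \<in> borel_measurable M"
  shows "tail_bound 0 M X x = emeasure M {\<omega> \<in> space M. x \<le> X \<omega>}"
proof -
  have "(\<integral>\<^sup>+ \<omega>. ennreal (tail_h 0 (l * (X \<omega> - x))) \<partial>M) = emeasure M {\<omega> \<in> space M. x \<le> X \<omega>}"
    if "l \<in> {0<..}" for l
  proof -
    have "(\<integral>\<^sup>+ \<omega>. ennreal (tail_h 0 (l * (X \<omega> - x))) \<partial>M)
        = (\<integral>\<^sup>+ \<omega>. indicator {\<omega> \<in> space M. x \<le> X \<omega>} \<omega> \<partial>M)"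
      using that
      by (intro nn_integral_cong) (auto simp: tail_h_def indicator_def zero_le_mult_iff)
    also have "\<dots> = emeasure M {\<omega> \<in> space M. x \<le> X \<omega>}"
      using assms by (intro nn_integral_indicator) measurable
    finally show ?thesis .
  qed
  then have "tail_bound 0 M X x = (INF l\<in>{0::real<..}. emeasure M {\<omega> \<in> space M. x \<le> X \<omega>})"
    unfolding tail_bound_def by (intro INF_cong refl)
  then show ?thesis
    by simp
qed

definition exp_moments :: "'a measure \<Rightarrow> ('a \<Rightarrow> real) \<Rightarrow> real set" where
  "exp_moments M X = {l. 0 < l \<and> (\<integral>\<^sup>+ \<omega>. ennreal (exp (l * X \<omega>)) \<partial>M) < \<infinity>}"

definition rv_class :: "ennreal \<Rightarrow> 'a measure \<Rightarrow> ('a \<Rightarrow> real) set" where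
  "rv_class \<alpha> M =
     (if \<alpha> = 0 then borel_measurable M
      else if \<alpha> = \<infinity> then {X \<in> borel_measurable M. exp_moments M X \<noteq> {}}
      else {X \<in> borel_measurable M.
              (\<integral>\<^sup>+ \<omega>. ennreal ((max 0 (X \<omega>)) powr enn2real \<alpha>) \<partial>M) < \<infinity>})"

definition distr_support :: "'a measure \<Rightarrow> ('a \<Rightarrow> real) \<Rightarrow> real set" where
  "distr_support M X =
     {y. \<forall>U. open U \<and> y \<in> U \<longrightarrow> 0 < emeasure (distr M borel X) U}"

definition x_star :: "'a measure \<Rightarrow> ('a \<Rightarrow> real) \<Rightarrow> ereal" where
  "x_star M X = (SUP y\<in>distr_support M X. ereal y)"

definition p_star :: "'a measure \<Rightarrow> ('a \<Rightarrow> real) \<Rightarrow> real" where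
  "p_star M X = measure M {\<omega> \<in> space M. ereal (X \<omega>) = x_star M X}"

definition dom_index :: "ennreal \<Rightarrow> real set" where
  "dom_index \<alpha> = (if \<alpha> = \<infinity> then {0<..} else UNIV)"

definition dom_gen :: "ennreal \<Rightarrow> real \<Rightarrow> real \<Rightarrow> real" where
  "dom_gen \<alpha> t u =
     (if \<alpha> = 0 then (if u > t then 1 else 0)
      else if \<alpha> = \<infinity> then exp (u / t)
      else (max 0 (u - t)) powr enn2real \<alpha>)"

text \<open>
  Membership requires the defining integral to be finite for every \<open>u\<close>, since the members are
  real-valued functions; \<^const>\<open>has_bochner_integral\<close> includes this integrability. The measure
  \<open>\<mu>\<close> need not be finite.
\<close>

definition dom_class :: "ennreal \<Rightarrow> (real \<Rightarrow> real) set" where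
  "dom_class \<alpha> =
     {g. \<exists>\<mu>. sets \<mu> = sets (restrict_space borel (dom_index \<alpha>)) \<and>
             (\<forall>u. has_bochner_integral \<mu> (\<lambda>t. dom_gen \<alpha> t u) (g u))}"

text \<open>
  \<open>stoch_dom \<gamma> M X N Y\<close> is stochastic dominance of order \<open>\<gamma> = \<alpha> + 1 \<in> [1,\<infinity>]\<close> of \<open>X\<close> on \<open>M\<close>
  by \<open>Y\<close> on \<open>N\<close>; in \<^typ>\<open>ennreal\<close>, \<open>(\<alpha> + 1) - 1 = \<alpha>\<close> also for \<open>\<alpha> = \<infinity>\<close>.
\<close>

definition stoch_dom ::
    "ennreal \<Rightarrow> 'a measure \<Rightarrow> ('a \<Rightarrow> real) \<Rightarrow> 'b measure \<Rightarrow> ('b \<Rightarrow> real) \<Rightarrow> bool" where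
  "stoch_dom \<gamma> M X N Y \<longleftrightarrow>
     (\<forall>g\<in>dom_class (\<gamma> - 1).
        (\<integral>\<^sup>+ \<omega>. ennreal (g (X \<omega>)) \<partial>M) \<le> (\<integral>\<^sup>+ \<omega>. ennreal (g (Y \<omega>)) \<partial>N))"

text \<open>The conventions \<open>0\<^sup>-\<^sup>a = \<infinity>\<close> (for \<open>a > 0\<close>) and \<open>ln 0 = -\<infinity>\<close>.\<close>

definition neg_power :: "ennreal \<Rightarrow> real \<Rightarrow> ereal" where
  "neg_power p a =
     (if p = 0 then \<infinity> else if p = \<infinity> then 0 else ereal (enn2real p powr (- a)))"

definition ext_ln :: "ennreal \<Rightarrow> ereal" where
  "ext_ln p = (if p = 0 then - \<infinity> else if p = \<infinity> then \<infinity> else ereal (ln (enn2real p)))"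

text \<open>
  Convexity of \<open>(-\<infinity>,\<infinity>]\<close>-valued and concavity of \<open>[-\<infinity>,\<infinity>)\<close>-valued functions, so that no
  \<open>\<infinity> - \<infinity>\<close> occurs; \<open>0 * \<infinity> = 0\<close> makes the cases \<open>u = 0\<close> and \<open>v = 0\<close> trivial.
\<close>

definition ereal_convex :: "(real \<Rightarrow> ereal) \<Rightarrow> bool" where
  "ereal_convex f \<longleftrightarrow> (\<forall>x. f x \<noteq> - \<infinity>) \<and>
     (\<forall>x y. \<forall>u\<ge>0. \<forall>v\<ge>0. u + v = 1 \<longrightarrow>
        f (u * x + v * y) \<le> ereal u * f x + ereal v * f y)"

definition ereal_concave :: "(real \<Rightarrow> ereal) \<Rightarrow> bool" where
  "ereal_concave f \<longleftrightarrow> (\<forall>x. f x \<noteq> \<infinity>) \<and>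
     (\<forall>x y. \<forall>u\<ge>0. \<forall>v\<ge>0. u + v = 1 \<longrightarrow>
        ereal u * f x + ereal v * f y \<le> f (u * x + v * y))"

text \<open>
  The uniform integrability condition for a sequence \<open>Y n\<close> of random variables on \<open>N n\<close>, with
  limit \<open>X\<close> on \<open>M\<close>; the limit enters only through its exponential moments, when \<open>\<alpha> = \<infinity>\<close>.
\<close>

definition tail_unif_integrable ::
    "ennreal \<Rightarrow> 'a measure \<Rightarrow> ('a \<Rightarrow> real) \<Rightarrow> (nat \<Rightarrow> 'b measure) \<Rightarrow> (nat \<Rightarrow> 'b \<Rightarrow> real) \<Rightarrow> bool"
  where
  "tail_unif_integrable \<alpha> M X N Y \<longleftrightarrow>
     (if \<alpha> = \<infinity> then
        \<forall>l\<in>exp_moments M X.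
          ((\<lambda>K::real. SUP n. \<integral>\<^sup>+ \<omega>. ennreal (exp (l * Y n \<omega>)) * indicator {\<omega>. Y n \<omega> > K} \<omega> \<partial>N n)
             \<longlongrightarrow> 0) at_top
      else
        ((\<lambda>K::real. SUP n. \<integral>\<^sup>+ \<omega>. ennreal ((max 0 (Y n \<omega>)) powr enn2real \<alpha>)
                                    * indicator {\<omega>. Y n \<omega> > K} \<omega> \<partial>N n)
             \<longlongrightarrow> 0) at_top)"

end

theory Submission
  imports Defs
begin

text \<open>
  The bound is an infimum over \<open>l > 0\<close> of means of \<open>tail_h \<alpha> (l * (X - x))\<close>, and the order properties
  hold already for these means. Monotonicity in the order of dominance holds because each generator
  of a higher order is a mixture of generators of a lower one. Concavity in \<open>x\<close> holds because, in the
  variable \<open>t = x - \<alpha> / l\<close>, the bound to the power \<open>- 1 / \<alpha>\<close> is a supremum of functions affine in \<open>x\<close>.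

  For the stability properties, upper semicontinuity follows from convergence of the mean at each
  fixed \<open>l\<close>. Lower semicontinuity follows from Fatou's lemma along almost minimal values of \<open>l\<close>, which
  have a limit point in \<open>[0,\<infinity>]\<close>. Only the point \<open>\<infinity>\<close> is critical, and it is harmful only if \<open>X \<le> x\<close>
  almost surely; but then the bound is just the probability of \<open>X = x\<close>.
\<close>

subsection \<open>The functions \<open>tail_h\<close>\<close>

text \<open>The three stability properties share one Fatou lemma, in which the parameter, the point
  and the random variable all vary at once. It requires almost sure convergence on one space; for
  convergence in distribution Skorohod's representation provides this, and it changes no bound
  because bounds depend only on laws. When X \<le> x almost surely the bound is the same for every
  parameter, so stability in \<alpha> has no exceptional point. Moving x to the right of an atom at
  the top of the support, or moving X to the left of it, can make the bound drop to 0, so stability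
  in x and in X do have one. A second obstacle is that \<open>tail_h 0\<close> jumps at 0, which is
  why the parameter 0 is treated separately.\<close>

lemma ennreal_param_cases [case_names zero real top]:
  fixes \<alpha> :: ennreal
  obtains "\<alpha> = 0" | a where "0 < a" "\<alpha> = ennreal a" | "\<alpha> = \<top>"
  by (metis ennreal_cases ennreal_0 order_le_less)

lemma tail_h_0: "tail_h 0 u = (if 0 \<le> u then 1 else 0)"
  by (simp add: tail_h_def)

lemma tail_h_ennreal: "0 < a \<Longrightarrow> tail_h (ennreal a) u = max 0 (1 + u / a) powr a"
  by (simp add: tail_h_def)

lemma tail_h_top: "tail_h \<top> u = exp u"
  by (simp add: tail_h_def)

lemma tail_h_nonneg [simp]: "0 \<le> tail_h \<alpha> u"
  by (simp add: tail_h_def)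

lemma tail_h_at_0 [simp]: "tail_h \<alpha> 0 = 1"
  by (simp add: tail_h_def)

lemma tail_h_measurable [measurable]: "tail_h \<alpha> \<in> borel_measurable borel"
proof (cases \<alpha> rule: ennreal_param_cases)
  case zero
  show ?thesis unfolding zero tail_h_0[abs_def] by measurable
next
  case (real a)
  show ?thesis unfolding real(2) tail_h_ennreal[OF real(1), abs_def] by measurable
next
  case top
  show ?thesis unfolding top tail_h_top[abs_def] by measurable
qed

lemma tail_h_mono: "u \<le> v \<Longrightarrow> tail_h \<alpha> u \<le> tail_h \<alpha> v"
  by (cases \<alpha> rule: ennreal_param_cases)
     (auto simp: tail_h_0 tail_h_ennreal tail_h_top divide_right_mono intro!: powr_mono2 max.mono)

lemma tail_h_le_1: "u \<le> 0 \<Longrightarrow> tail_h \<alpha> u \<le> 1"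
  using tail_h_mono[of u 0] by simp

lemma tail_h_ge_1: "0 \<le> u \<Longrightarrow> 1 \<le> tail_h \<alpha> u"
  using tail_h_mono[of 0 u] by simp

text \<open>The weighted arithmetic-geometric mean inequality, with weights b/c and 1 - b/c for 1 +
  u/b and 1: their arithmetic mean is 1 + u/c. Raising to the power c gives the claim.\<close>

lemma powr_one_plus_divide_mono:
  fixes b c :: real
  assumes "0 < b" "b \<le> c"
  shows "max 0 (1 + u / b) powr b \<le> max 0 (1 + u / c) powr c"
proof (cases "0 < 1 + u / b")
  case True
  have "(1 + u / b) powr (b / c) * 1 powr (1 - b / c) \<le> (b / c) * (1 + u / b) + (1 - b / c) * 1"
    using assms True by (intro Youngs_inequality_0) (auto simp: field_simps)
  also have "\<dots> = 1 + u / c"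
    using assms by (simp add: field_simps)
  finally have *: "(1 + u / b) powr (b / c) \<le> 1 + u / c"
    by simp
  have "(1 + u / b) powr b = ((1 + u / b) powr (b / c)) powr c"
    using assms by (simp add: powr_powr)
  also have "\<dots> \<le> (1 + u / c) powr c"
    using assms * by (intro powr_mono2) auto
  finally show ?thesis
    using True order.trans[OF powr_ge_zero *] by (simp add: max_def)
qed (use assms in \<open>auto simp: max_def\<close>)

lemma tail_h_ennreal_le_exp:
  assumes "0 < a"
  shows "tail_h (ennreal a) u \<le> exp u"
proof (cases "0 < 1 + u / a")
  case True
  have "a * ln (1 + u / a) \<le> a * (u / a)"
    using assms True ln_add_one_self_le_self2[of "u / a"] by (intro mult_left_mono) auto
  then show ?thesis
    using assms True by (simp add: tail_h_ennreal powr_def max_def)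
qed (use assms in \<open>simp add: tail_h_ennreal max_def\<close>)

lemma tail_h_mono_param:
  assumes "\<alpha> \<le> \<beta>"
  shows "tail_h \<alpha> u \<le> tail_h \<beta> u"
proof (cases \<alpha> rule: ennreal_param_cases)
  case zero
  then show ?thesis
    using tail_h_ge_1[of u \<beta>] by (simp add: tail_h_0)
next
  case a: (real a)
  show ?thesis
  proof (cases \<beta> rule: ennreal_param_cases)
    case zero
    with a assms show ?thesis by (simp add: ennreal_eq_0_iff)
  next
    case (real b)
    with a assms have "a \<le> b" by simp
    with a real show ?thesis
      by (simp add: tail_h_ennreal powr_one_plus_divide_mono)
  next
    case top
    with a tail_h_ennreal_le_exp[of a u] show ?thesis
      by (simp add: tail_h_top)
  qed
next
  case top
  with assms show ?thesis
    by (simp add: top_unique)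
qed

text \<open>Parameter and argument move together because in the Fatou argument l, the variable and
  the point change with n. The alternative \<open>fin\<close> covers both uses: finite parameters
  tending to \<alpha> (possibly \<infinity>), and a constant parameter.\<close>

lemma tail_h_tendsto:
  assumes "0 < \<alpha>" and a: "a \<longlonglongrightarrow> \<alpha>" and u: "u \<longlonglongrightarrow> v"
    and fin: "(\<forall>n. a n < \<infinity>) \<or> (\<forall>n. a n = \<alpha>)"
  shows "(\<lambda>n. tail_h (a n) (u n)) \<longlonglongrightarrow> tail_h \<alpha> v"
proof (cases \<alpha> rule: ennreal_param_cases)
  case zero
  with assms show ?thesis by simp
next
  case (real b)
  have r: "(\<lambda>n. enn2real (a n)) \<longlonglongrightarrow> b"
    using a real by (metis enn2real_ennreal ennreal_less_top order_less_imp_le tendsto_enn2real)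
  have "\<forall>\<^sub>F n in sequentially. a n > 0" "\<forall>\<^sub>F n in sequentially. a n < \<infinity>"
    using a real by (auto intro!: order_tendstoD)
  then have ev: "\<forall>\<^sub>F n in sequentially.
      max 0 (1 + u n / enn2real (a n)) powr enn2real (a n) = tail_h (a n) (u n)"
    by eventually_elim (auto simp: tail_h_def)
  have "(\<lambda>n. max 0 (1 + u n / enn2real (a n)) powr enn2real (a n))
      \<longlonglongrightarrow> max 0 (1 + v / b) powr b"
    using real by (intro tendsto_intros r u) auto
  then show ?thesis
    using Lim_transform_eventually[OF _ ev] real by (simp add: tail_h_ennreal)
next
  case top
  show ?thesis
  proof (cases "\<forall>n. a n = \<alpha>")
    case True
    then show ?thesis
      using top u by (auto simp: tail_h_top intro!: tendsto_intros)
  next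
    case False
    with fin have fin: "a n < \<infinity>" for n by blast
    define r where "r n = enn2real (a n)" for n
    have ar: "a n = ennreal (r n)" for n
      using fin[of n] by (simp add: r_def)
    have r: "filterlim r at_top sequentially"
      unfolding filterlim_at_top_dense
    proof
      fix K :: real
      have "\<forall>\<^sub>F n in sequentially. ennreal (max 0 K) < a n"
        using a top by (intro order_tendstoD) auto
      then show "\<forall>\<^sub>F n in sequentially. K < r n"
      proof eventually_elim
        case (elim n)
        then show ?case
          using ennreal_less_iff[of "max 0 K" "r n"] unfolding ar by auto
      qed
    qed
    have w: "(\<lambda>n. u n / r n) \<longlonglongrightarrow> 0"
      by (rule real_tendsto_divide_at_top[OF u r])
    have ev: "\<forall>\<^sub>F n in sequentially. 0 < r n \<and> -1 < u n / r n"
      using r order_tendstoD(1)[OF w, of "-1"] by (auto simp: filterlim_at_top_dense eventually_conj_iff)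
    \<comment> \<open>Squeezed by y / (1 + y) \<le> ln (1 + y) \<le> y at y = u / r, multiplied by
      r; this handles an argument u that still varies with n.\<close>
    have lim: "(\<lambda>n. r n * ln (1 + u n / r n)) \<longlonglongrightarrow> v"
    proof (rule tendsto_sandwich)
      show "(\<lambda>n. u n / (1 + u n / r n)) \<longlonglongrightarrow> v"
        using tendsto_divide[OF u tendsto_add[OF tendsto_const[of 1] w]] by simp
      show "\<forall>\<^sub>F n in sequentially. u n / (1 + u n / r n) \<le> r n * ln (1 + u n / r n)"
        using ev
      proof eventually_elim
        case (elim n)
        have "r n * (1 - 1 / (1 + u n / r n)) \<le> r n * ln (1 + u n / r n)"
          using elim ln_le_minus_one[of "1 / (1 + u n / r n)"]
          by (intro mult_left_mono) (auto simp: ln_div)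
        moreover have "r n * (1 - 1 / (1 + u n / r n)) = u n / (1 + u n / r n)"
          using elim by (subst diff_divide_eq_iff) auto
        ultimately show ?case by simp
      qed
      show "\<forall>\<^sub>F n in sequentially. r n * ln (1 + u n / r n) \<le> u n"
        using ev
      proof eventually_elim
        case (elim n)
        then show ?case
          using mult_left_mono[OF ln_add_one_self_le_self2[of "u n / r n"], of "r n"] by simp
      qed
    qed (rule u)
    have "\<forall>\<^sub>F n in sequentially. exp (r n * ln (1 + u n / r n)) = tail_h (a n) (u n)"
      using ev by eventually_elim (simp add: ar tail_h_ennreal powr_def max_def)
    then show ?thesis
      using Lim_transform_eventually[OF tendsto_exp[OF lim]] top by (simp add: tail_h_top)
  qed
qed

text \<open>Monotonicity in the parameter reduces the claim to a finite c > 0, for which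
  \<open>tail_h\<close> is a positive power of a linearly growing function.\<close>

lemma tail_h_at_top:
  assumes "0 < \<alpha>"
  shows "filterlim (tail_h \<alpha>) at_top at_top"
proof -
  have "\<exists>c>0. ennreal c \<le> \<alpha>"
    using assms by (cases \<alpha> rule: ennreal_param_cases) (auto intro: exI[of _ 1])
  then obtain c where c: "0 < c" "ennreal c \<le> \<alpha>" by blast
  have "filterlim (\<lambda>u. max 0 (1 + u / c)) at_top at_top"
    by (rule filterlim_at_top_mono[of "\<lambda>u. u * inverse c"])
       (use c in \<open>auto intro!: filterlim_at_top_mult_tendsto_pos[OF tendsto_const] filterlim_ident always_eventually simp: divide_inverse max.coboundedI2\<close>)
  moreover have "filterlim (\<lambda>y. y powr c) at_top at_top"
  proof (rule filterlim_at_top_mono)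
    show "filterlim (\<lambda>y. exp (c * ln y)) at_top at_top"
      by (intro filterlim_compose[OF exp_at_top] filterlim_tendsto_pos_mult_at_top[OF tendsto_const c(1)] ln_at_top)
    show "\<forall>\<^sub>F y in at_top. exp (c * ln y) \<le> y powr c"
      using eventually_gt_at_top[of 0] by eventually_elim (simp add: powr_def)
  qed
  ultimately have "filterlim (\<lambda>u. max 0 (1 + u / c) powr c) at_top at_top"
    by (rule filterlim_compose[rotated])
  then show ?thesis
    using c tail_h_mono_param[OF c(2)]
    by (elim filterlim_at_top_mono) (simp add: tail_h_ennreal)
qed

text \<open>Gives \<open>tail_h \<alpha> u\<close> \<rightarrow> 1 as \<alpha> \<rightarrow> 0 for
  fixed u \<ge> 0. The crude ln (1 + y) \<le> y with y = u / a yields only the exponent u;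
  estimating 1 + y \<le> (1 + sqrt y)^2 first yields 2 sqrt (u a), which tends to 0 with a.\<close>

lemma tail_h_upper_small:
  assumes "\<alpha> < \<infinity>" "0 \<le> u"
  shows "tail_h \<alpha> u \<le> exp (2 * sqrt (u * enn2real \<alpha>))"
proof (cases \<alpha> rule: ennreal_param_cases)
  case zero
  with assms show ?thesis by (simp add: tail_h_0)
next
  case (real a)
  define y where "y = u / a"
  have y: "0 \<le> y" using assms real by (simp add: y_def)
  have "ln (1 + y) \<le> ln ((1 + sqrt y)\<^sup>2)"
    using y by (intro ln_mono) (auto simp: power2_eq_square algebra_simps add_pos_nonneg)
  also have "\<dots> = 2 * ln (1 + sqrt y)"
    using y by (subst ln_realpow) (auto simp: add_pos_nonneg)
  also have "\<dots> \<le> 2 * sqrt y"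
    using y ln_add_one_self_le_self[of "sqrt y"] by simp
  finally have "a * ln (1 + y) \<le> a * (2 * sqrt y)"
    using real by simp
  also have "a * (2 * sqrt y) = 2 * sqrt (u * a)"
    using real by (simp add: y_def real_sqrt_divide real_sqrt_mult field_simps)
  finally show ?thesis
    using assms real y by (simp add: tail_h_ennreal powr_def max_def y_def)
qed (use assms in simp_all)

subsection \<open>Order properties and invariance\<close>

definition tail_mean :: "ennreal \<Rightarrow> 'a measure \<Rightarrow> ('a \<Rightarrow> real) \<Rightarrow> real \<Rightarrow> real \<Rightarrow> ennreal" where
  "tail_mean \<alpha> M X x l = (\<integral>\<^sup>+ \<omega>. ennreal (tail_h \<alpha> (l * (X \<omega> - x))) \<partial>M)"

lemma tail_bound_eq_INF: "tail_bound \<alpha> M X x = (INF l\<in>{0<..}. tail_mean \<alpha> M X x l)"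
  by (simp add: tail_bound_def tail_mean_def)

lemma tail_bound_le: "0 < l \<Longrightarrow> tail_bound \<alpha> M X x \<le> tail_mean \<alpha> M X x l"
  unfolding tail_bound_eq_INF by (rule INF_lower) simp

lemma tail_bound_mono:
  assumes "\<And>l. 0 < l \<Longrightarrow> tail_mean \<alpha> M X x l \<le> tail_mean \<beta> N Y y l"
  shows "tail_bound \<alpha> M X x \<le> tail_bound \<beta> N Y y"
  unfolding tail_bound_eq_INF using assms by (auto intro!: INF_mono)

lemma tail_mean_mono:
  assumes "0 < l" "AE \<omega> in M. X \<omega> - x \<le> Y \<omega> - y"
  shows "tail_mean \<alpha> M X x l \<le> tail_mean \<alpha> M Y y l"
  unfolding tail_mean_def
  by (rule nn_integral_mono_AE, rule AE_mp[OF assms(2)])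
     (use assms(1) in \<open>auto intro!: AE_I2 ennreal_leI tail_h_mono\<close>)

lemma tail_mean_mono_param: "\<alpha> \<le> \<beta> \<Longrightarrow> tail_mean \<alpha> M X x l \<le> tail_mean \<beta> M X x l"
  unfolding tail_mean_def by (intro nn_integral_mono ennreal_leI tail_h_mono_param)

lemma tail_bound_mono_AE:
  "AE \<omega> in M. X \<omega> \<le> Y \<omega> \<Longrightarrow> tail_bound \<alpha> M X x \<le> tail_bound \<alpha> M Y x"
  by (intro tail_bound_mono tail_mean_mono) auto

lemma tail_bound_antimono: "antimono (tail_bound \<alpha> M X)"
  by (intro antimonoI tail_bound_mono tail_mean_mono) auto

lemma tail_bound_mono_param: "\<alpha> \<le> \<beta> \<Longrightarrow> tail_bound \<alpha> M X x \<le> tail_bound \<beta> M X x"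
  by (intro tail_bound_mono tail_mean_mono_param)

lemma tail_mean_distr:
  "X \<in> borel_measurable M \<Longrightarrow>
    tail_mean \<alpha> M X x l = (\<integral>\<^sup>+ u. ennreal (tail_h \<alpha> (l * (u - x))) \<partial>distr M borel X)"
  unfolding tail_mean_def by (subst nn_integral_distr) auto

lemma tail_bound_distr_cong:
  assumes "X \<in> borel_measurable M" "Y \<in> borel_measurable N" "distr M borel X = distr N borel Y"
  shows "tail_bound \<alpha> M X x = tail_bound \<alpha> N Y x"
  unfolding tail_bound_eq_INF using assms by (simp add: tail_mean_distr)

lemma tail_bound_translate: "tail_bound \<alpha> M (\<lambda>\<omega>. X \<omega> + c) (x + c) = tail_bound \<alpha> M X x"
  by (simp add: tail_bound_def)

lemma tail_bound_scale:
  assumes "0 < \<kappa>"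
  shows "tail_bound \<alpha> M (\<lambda>\<omega>. \<kappa> * X \<omega>) (\<kappa> * x) = tail_bound \<alpha> M X x"
proof (rule antisym)
  have eq: "tail_mean \<alpha> M (\<lambda>\<omega>. \<kappa> * X \<omega>) (\<kappa> * x) l = tail_mean \<alpha> M X x (l * \<kappa>)" for l
    by (simp add: tail_mean_def algebra_simps)
  show "tail_bound \<alpha> M X x \<le> tail_bound \<alpha> M (\<lambda>\<omega>. \<kappa> * X \<omega>) (\<kappa> * x)"
    unfolding tail_bound_eq_INF[of _ _ "\<lambda>\<omega>. \<kappa> * X \<omega>"] eq
    by (intro INF_greatest tail_bound_le) (use assms in auto)
  show "tail_bound \<alpha> M (\<lambda>\<omega>. \<kappa> * X \<omega>) (\<kappa> * x) \<le> tail_bound \<alpha> M X x"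
    unfolding tail_bound_eq_INF[of _ _ X]
  proof (rule INF_greatest)
    fix l :: real
    assume "l \<in> {0<..}"
    then show "tail_bound \<alpha> M (\<lambda>\<omega>. \<kappa> * X \<omega>) (\<kappa> * x) \<le> tail_mean \<alpha> M X x l"
      using tail_bound_le[of "l / \<kappa>" \<alpha> M "\<lambda>\<omega>. \<kappa> * X \<omega>" "\<kappa> * x"] assms by (simp add: eq)
  qed
qed

section \<open>Finite means and the extreme values of the bound\<close>

lemma rv_class_measurable: "X \<in> rv_class \<alpha> M \<Longrightarrow> X \<in> borel_measurable M"
  by (auto simp: rv_class_def split: if_splits)

lemma tail_mean_0_le_1:
  assumes "prob_space M"
  shows "tail_mean 0 M X x l \<le> 1"
proof -
  interpret prob_space M by fact
  have "tail_mean 0 M X x l \<le> (\<integral>\<^sup>+ \<omega>. 1 \<partial>M)"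
    unfolding tail_mean_def by (intro nn_integral_mono) (simp add: tail_h_0)
  then show ?thesis
    by (simp add: emeasure_space_1)
qed

text \<open>Both estimates come from one linear bound by max 1 u. The first makes means finite under
  the moment condition; the second, beyond 1, feeds the uniform integrability argument.\<close>

lemma tail_h_le_powr:
  assumes a: "0 < a" and "0 < l"
  obtains C where "0 \<le> C" "\<And>u. tail_h (ennreal a) (l * (u - x)) \<le> C * (1 + max 0 u powr a)"
    "\<And>u. 1 \<le> u \<Longrightarrow> tail_h (ennreal a) (l * (u - x)) \<le> C * u powr a"
proof
  \<comment> \<open>The terms 1, l * u / a and l * |x| / a are at most 1, l / a and l * |x| / a
    times max 1 u; D is the sum of these coefficients.\<close>
  define D where "D = 1 + (l + l * \<bar>x\<bar>) / a"
  have D: "0 \<le> D" using assms by (simp add: D_def)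
  have lin: "max 0 (1 + l * (u - x) / a) \<le> D * max 1 u" for u
  proof -
    have "l * (u - x) \<le> l * u + l * \<bar>x\<bar>"
      using assms by (simp add: distrib_left[symmetric] mult_left_mono)
    also have "l * u \<le> l * max 1 u"
      using assms by (intro mult_left_mono) auto
    also have "l * \<bar>x\<bar> \<le> l * \<bar>x\<bar> * max 1 u"
      using assms mult_left_mono[of 1 "max 1 u" "l * \<bar>x\<bar>"] by simp
    finally have "l * (u - x) \<le> (l + l * \<bar>x\<bar>) * max 1 u"
      by (simp add: algebra_simps)
    then have "1 + l * (u - x) / a \<le> max 1 u + (l + l * \<bar>x\<bar>) * max 1 u / a"
      using a by (intro add_mono divide_right_mono) auto
    also have "\<dots> = D * max 1 u"
      by (simp add: D_def algebra_simps add_divide_distrib)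
    finally show ?thesis
      using D by simp
  qed
  have le: "tail_h (ennreal a) (l * (u - x)) \<le> D powr a * max 1 u powr a" for u
    using a lin[of u] D by (simp add: tail_h_ennreal powr_mono2 flip: powr_mult)
  show "0 \<le> D powr a" by simp
  show "tail_h (ennreal a) (l * (u - x)) \<le> D powr a * u powr a" if "1 \<le> u" for u
    using le[of u] that by simp
  have "max 1 u powr a \<le> 1 + max 0 u powr a" for u
    by (cases "1 \<le> u") auto
  then show "tail_h (ennreal a) (l * (u - x)) \<le> D powr a * (1 + max 0 u powr a)" for u
    using le[of u] by (meson mult_left_mono order_trans powr_ge_zero)
qed

lemma tail_mean_finite_real:
  assumes "prob_space M" "X \<in> rv_class (ennreal a) M" "0 < a" "0 < l"
  shows "tail_mean (ennreal a) M X x l < \<infinity>"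
proof -
  interpret prob_space M by fact
  have [measurable]: "X \<in> borel_measurable M"
    using assms(2) by (rule rv_class_measurable)
  obtain C where C: "0 \<le> C" "\<And>u. tail_h (ennreal a) (l * (u - x)) \<le> C * (1 + max 0 u powr a)"
    by (rule tail_h_le_powr[OF assms(3,4)]) blast
  have "tail_mean (ennreal a) M X x l \<le> (\<integral>\<^sup>+ \<omega>. ennreal C * (1 + ennreal (max 0 (X \<omega>) powr a)) \<partial>M)"
    unfolding tail_mean_def
    using C(1) by (intro nn_integral_mono order.trans[OF ennreal_leI[OF C(2)]])
      (simp add: ennreal_mult)
  also have "\<dots> = ennreal C * (1 + (\<integral>\<^sup>+ \<omega>. ennreal (max 0 (X \<omega>) powr a) \<partial>M))"
    by (simp add: nn_integral_cmult nn_integral_add emeasure_space_1)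
  also have "\<dots> < \<infinity>"
    using assms by (simp add: rv_class_def ennreal_mult_less_top ennreal_eq_0_iff)
  finally show ?thesis .
qed

lemma tail_mean_top:
  "X \<in> borel_measurable M \<Longrightarrow>
    tail_mean \<top> M X x l = ennreal (exp (- l * x)) * (\<integral>\<^sup>+ \<omega>. ennreal (exp (l * X \<omega>)) \<partial>M)"
  unfolding tail_mean_def tail_h_top
  by (subst nn_integral_cmult[symmetric])
     (auto simp flip: ennreal_mult exp_add simp: algebra_simps)

text \<open>One l serves all x. At \<alpha> = \<infinity> this holds because x enters the mean only
  through the finite positive factor exp (- l * x).\<close>

lemma tail_mean_finite_ex:
  assumes "prob_space M" "X \<in> rv_class \<alpha> M"
  obtains l where "0 < l" "\<And>x. tail_mean \<alpha> M X x l < \<infinity>"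
proof (cases \<alpha> rule: ennreal_param_cases)
  case zero
  then show ?thesis
    by (intro that[of 1]) (auto intro: order.strict_trans1[OF tail_mean_0_le_1[OF assms(1)]])
next
  case (real a)
  then show ?thesis
    using tail_mean_finite_real[OF assms(1), of X a 1] assms by (intro that[of 1]) auto
next
  case top
  then obtain l where "0 < l" "(\<integral>\<^sup>+ \<omega>. ennreal (exp (l * X \<omega>)) \<partial>M) < \<infinity>"
    using assms by (auto simp: rv_class_def exp_moments_def)
  then show ?thesis
    using top rv_class_measurable[OF assms(2)]
    by (intro that[of l]) (auto simp: tail_mean_top ennreal_mult_less_top)
qed

text \<open>As l \<rightarrow> 0 the integrand tends to \<open>tail_h \<alpha> 0\<close> = 1, hence
  the means tend to 1. This needs continuity of \<open>tail_h\<close> at 0, so \<alpha> = 0 is read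
  off from the probability instead.\<close>

lemma tail_bound_le_1:
  assumes "prob_space M" "X \<in> rv_class \<alpha> M"
  shows "tail_bound \<alpha> M X x \<le> 1"
proof (cases "\<alpha> = 0")
  case True
  then show ?thesis
    using assms prob_space.emeasure_le_1[OF assms(1)] by (simp add: tail_bound_0 rv_class_measurable)
next
  case False
  interpret prob_space M by fact
  have [measurable]: "X \<in> borel_measurable M"
    using assms(2) by (rule rv_class_measurable)
  obtain l where l: "0 < l" "tail_mean \<alpha> M X x l < \<infinity>"
    using tail_mean_finite_ex[OF assms] by metis
  \<comment> \<open>Staying below l matters: where X \<ge> x the integrand at s n is dominated by
    the one at l, whose mean is finite, and elsewhere by 1.\<close>
  define s where "s n = l / real (Suc n)" for n
  have s: "0 < s n" "s n \<le> l" for n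
    using l by (auto simp: s_def field_simps)
  have s0: "s \<longlonglongrightarrow> 0"
    unfolding s_def by (rule lim_const_over_n[THEN LIMSEQ_Suc])
  have "(\<lambda>n. tail_mean \<alpha> M X x (s n)) \<longlonglongrightarrow> (\<integral>\<^sup>+ \<omega>. 1 \<partial>M)"
    unfolding tail_mean_def
  proof (rule nn_integral_dominated_convergence[where w = "\<lambda>\<omega>. 1 + ennreal (tail_h \<alpha> (l * (X \<omega> - x)))"])
    show "AE \<omega> in M. ennreal (tail_h \<alpha> (s n * (X \<omega> - x))) \<le> 1 + ennreal (tail_h \<alpha> (l * (X \<omega> - x)))" for n
    proof (rule AE_I2)
      fix \<omega>
      have "tail_h \<alpha> (s n * (X \<omega> - x)) \<le> 1 + tail_h \<alpha> (l * (X \<omega> - x))"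
      proof (cases "0 \<le> X \<omega> - x")
        case True
        then have "tail_h \<alpha> (s n * (X \<omega> - x)) \<le> tail_h \<alpha> (l * (X \<omega> - x))"
          using s by (intro tail_h_mono mult_right_mono)
        then show ?thesis by simp
      next
        case False
        then have "tail_h \<alpha> (s n * (X \<omega> - x)) \<le> 1"
          using s[of n] by (intro tail_h_le_1) (simp add: mult_le_0_iff)
        then show ?thesis by (simp add: add_increasing2)
      qed
      then show "ennreal (tail_h \<alpha> (s n * (X \<omega> - x))) \<le> 1 + ennreal (tail_h \<alpha> (l * (X \<omega> - x)))"
        by (simp add: ennreal_plus[symmetric] ennreal_1[symmetric] ennreal_leI del: ennreal_plus ennreal_1)
    qed
    show "(\<integral>\<^sup>+ \<omega>. 1 + ennreal (tail_h \<alpha> (l * (X \<omega> - x))) \<partial>M) < \<infinity>"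
      using l(2) by (simp add: nn_integral_add emeasure_space_1 tail_mean_def)
    show "AE \<omega> in M. (\<lambda>n. ennreal (tail_h \<alpha> (s n * (X \<omega> - x)))) \<longlonglongrightarrow> 1"
    proof (rule AE_I2)
      fix \<omega>
      have "(\<lambda>n. tail_h \<alpha> (s n * (X \<omega> - x))) \<longlonglongrightarrow> tail_h \<alpha> 0"
        using False s0 tendsto_mult_right[OF s0, of "X \<omega> - x"]
        by (intro tail_h_tendsto) (auto simp: zero_less_iff_neq_zero)
      then show "(\<lambda>n. ennreal (tail_h \<alpha> (s n * (X \<omega> - x)))) \<longlonglongrightarrow> 1"
        using tendsto_ennrealI by fastforce
    qed
  qed measurable
  then show ?thesis
    using s by (intro LIMSEQ_le_const[where a = "tail_bound \<alpha> M X x"]) (auto simp: emeasure_space_1 intro!: tail_bound_le)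
qed

text \<open>By monotonicity in the parameter only \<alpha> = \<infinity> needs an argument: almost
  surely exp (n * (X - x)) is bounded by 1 and decreases to the indicator of X = x.\<close>

lemma tail_bound_eq_tail_bound_0:
  assumes "prob_space M" and X [measurable]: "X \<in> borel_measurable M" and AE: "AE \<omega> in M. X \<omega> \<le> x"
  shows "tail_bound \<alpha> M X x = tail_bound 0 M X x"
proof (rule antisym)
  interpret prob_space M by fact
  have "(\<lambda>n. tail_mean \<top> M X x (real n)) \<longlonglongrightarrow> (\<integral>\<^sup>+ \<omega>. indicator {\<omega> \<in> space M. x \<le> X \<omega>} \<omega> \<partial>M)"
    unfolding tail_mean_def
  proof (rule nn_integral_dominated_convergence[where w = "\<lambda>\<omega>. 1"])
    show "AE \<omega> in M. ennreal (tail_h \<top> (real n * (X \<omega> - x))) \<le> 1" for n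
      using AE by eventually_elim (auto intro!: tail_h_le_1 simp: mult_le_0_iff ennreal_le_1)
    show "AE \<omega> in M. (\<lambda>n. ennreal (tail_h \<top> (real n * (X \<omega> - x))))
        \<longlonglongrightarrow> indicator {\<omega> \<in> space M. x \<le> X \<omega>} \<omega>"
      using AE AE_space
    proof eventually_elim
      case (elim \<omega>)
      show ?case
      proof (cases "X \<omega> = x")
        case True
        with elim show ?thesis by simp
      next
        case False
        with elim have "X \<omega> - x < 0" by simp
        then have "(\<lambda>n. exp (real n * (X \<omega> - x))) \<longlonglongrightarrow> 0"
          unfolding exp_of_nat_mult by (intro LIMSEQ_power_zero) simp
        then show ?thesis
          using False elim tendsto_ennrealI[of _ 0] by (simp add: tail_h_top)
      qed
    qed
  qed (auto simp: emeasure_space_1)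
  also have "(\<integral>\<^sup>+ \<omega>. indicator {\<omega> \<in> space M. x \<le> X \<omega>} \<omega> \<partial>M) = tail_bound 0 M X x"
    by (subst nn_integral_indicator) (auto simp: tail_bound_0)
  finally have lim: "(\<lambda>n. tail_mean \<top> M X x (real n)) \<longlonglongrightarrow> tail_bound 0 M X x" .
  have "tail_bound \<alpha> M X x \<le> tail_bound \<top> M X x"
    by (rule tail_bound_mono_param) simp
  \<comment> \<open>From index 1 on: at n = 0 the value of l would not be positive.\<close>
  also have "\<dots> \<le> tail_bound 0 M X x"
    by (rule LIMSEQ_le_const[OF lim]) (auto intro!: exI[of _ 1] tail_bound_le)
  finally show "tail_bound \<alpha> M X x \<le> tail_bound 0 M X x" .
qed (simp add: tail_bound_mono_param)

lemma tail_bound_const: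
  assumes "prob_space M"
  shows "tail_bound \<alpha> M (\<lambda>_. c) x = (if x \<le> c then 1 else 0)"
proof (cases "x \<le> c")
  case True
  interpret prob_space M by fact
  have "(\<lambda>_. c) \<in> rv_class \<alpha> M"
    by (auto simp: rv_class_def exp_moments_def emeasure_space_1 intro!: exI[of _ 1])
  then have "tail_bound \<alpha> M (\<lambda>_. c) x \<le> 1"
    by (rule tail_bound_le_1[OF assms])
  moreover have "1 \<le> tail_bound \<alpha> M (\<lambda>_. c) x"
    unfolding tail_bound_eq_INF tail_mean_def using True
    by (intro INF_greatest) (auto simp: emeasure_space_1 tail_h_ge_1)
  ultimately show ?thesis
    using True by simp
next
  case False
  then show ?thesis
    using tail_bound_eq_tail_bound_0[OF assms, of "\<lambda>_. c" x \<alpha>] by (simp add: tail_bound_0)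
qed

subsection \<open>Semicontinuity\<close>

lemma exists_real_below:
  fixes \<alpha> :: ennreal
  assumes "0 < \<alpha>"
  obtains c where "0 < c" "ennreal c < \<alpha>"
proof -
  obtain z where "0 < z" "z < \<alpha>" using dense[OF assms] by blast
  moreover from this have "z < \<top>" using order.strict_trans2 top_greatest by blast
  ultimately show ?thesis
    by (intro that[of "enn2real z"]) (auto simp: enn2real_positive_iff)
qed

text \<open>The parameters vary with n, so divergence is inherited from a fixed c < \<alpha>, which
  lies below a n eventually.\<close>

lemma liminf_tail_h_at_top:
  assumes "0 < \<alpha>" "a \<longlonglongrightarrow> \<alpha>" and u: "filterlim u at_top sequentially"
  shows "liminf (\<lambda>n. ennreal (tail_h (a n) (u n))) = \<top>"
proof -
  obtain c where c: "0 < c" "ennreal c < \<alpha>"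
    using exists_real_below[OF assms(1)] .
  have lim: "filterlim (\<lambda>n. tail_h (ennreal c) (u n)) at_top sequentially"
    using c by (intro filterlim_compose[OF tail_h_at_top u]) auto
  have ev: "\<forall>\<^sub>F n in sequentially. ennreal c < a n"
    using assms c by (intro order_tendstoD)
  have "\<top> \<le> liminf (\<lambda>n. ennreal (tail_h (a n) (u n)))"
    unfolding le_Liminf_iff
  proof (intro allI impI)
    fix y :: ennreal
    assume "y < \<top>"
    then obtain t where t: "0 \<le> t" "y = ennreal t" by (cases y) auto
    have "\<forall>\<^sub>F n in sequentially. t < tail_h (ennreal c) (u n)"
      using lim by (simp add: filterlim_at_top_dense)
    with ev show "\<forall>\<^sub>F n in sequentially. y < ennreal (tail_h (a n) (u n))"
    proof eventually_elim
      case (elim n)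
      then have "t < tail_h (a n) (u n)"
        using tail_h_mono_param[OF less_imp_le[of "ennreal c" "a n"], of "u n"] by linarith
      then show ?case using t by (simp add: ennreal_less_iff)
    qed
  qed
  then show ?thesis by (simp add: top_unique)
qed

text \<open>
  Almost minimal values of the parameter \<open>l\<close> have a limit point \<open>L \<in> [0,\<infinity>]\<close>, and Fatou's lemma
  applies along it. The values \<open>L = 0\<close> and \<open>L = \<infinity>\<close> are harmless, since there the limiting mean
  is \<open>1\<close> and \<open>\<infinity>\<close>, respectively.
\<close>

lemma tail_bound_le_liminf:
  assumes "prob_space M"
    and [measurable]: "X \<in> borel_measurable M" "\<And>n. Y n \<in> borel_measurable M"
    and Y: "AE \<omega> in M. (\<lambda>n. Y n \<omega>) \<longlonglongrightarrow> X \<omega>" and y: "y \<longlonglongrightarrow> x"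
    and a: "0 < \<alpha>" "a \<longlonglongrightarrow> \<alpha>" "(\<forall>n. a n < \<infinity>) \<or> (\<forall>n. a n = \<alpha>)"
    and le_1: "tail_bound \<alpha> M X x \<le> 1" and exceeds: "\<not> (AE \<omega> in M. X \<omega> \<le> x)"
  shows "tail_bound \<alpha> M X x \<le> liminf (\<lambda>n. tail_bound (a n) M (Y n) (y n))"
  unfolding le_Liminf_iff
proof (intro allI impI, rule ccontr)
  interpret prob_space M by fact
  fix z
  assume z: "z < tail_bound \<alpha> M X x"
    and "\<not> (\<forall>\<^sub>F n in sequentially. z < tail_bound (a n) M (Y n) (y n))"
  then obtain r :: "nat \<Rightarrow> nat" where r: "strict_mono r" "\<And>n. tail_bound (a (r n)) M (Y (r n)) (y (r n)) \<le> z"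
    by (force dest: not_eventually_sequentiallyD simp: not_less)
  \<comment> \<open>w leaves room above z: an infimum need not be attained, but some l has a mean
    below w.\<close>
  obtain w where w: "z < w" "w < tail_bound \<alpha> M X x"
    using dense[OF z] by blast
  have "\<exists>l. 0 < l \<and> tail_mean (a (r n)) M (Y (r n)) (y (r n)) l < w" for n
    using order.strict_trans1[OF r(2) w(1), of n] by (auto simp: tail_bound_eq_INF INF_less_iff)
  then obtain l where l: "\<And>n. 0 < l n" "\<And>n. tail_mean (a (r n)) M (Y (r n)) (y (r n)) (l n) < w"
    by metis
  \<comment> \<open>Compactness of the extended reals; \<open>ereal\<close> allows the limit point
    \<infinity>.\<close>
  obtain s L where s: "strict_mono s" "((\<lambda>n. ereal (l n)) \<circ> s) \<longlonglongrightarrow> L"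
    using compact_complete_linorder by blast
  define q where "q n = r (s n)" for n
  define u where "u n \<omega> = l (s n) * (Y (q n) \<omega> - y (q n))" for n \<omega>
  have q: "strict_mono q"
    using r(1) s(1) by (auto simp: q_def strict_mono_def)
  note sub = LIMSEQ_subseq_LIMSEQ[OF _ q, unfolded comp_def]
  have "(\<integral>\<^sup>+ \<omega>. liminf (\<lambda>n. ennreal (tail_h (a (q n)) (u n \<omega>))) \<partial>M)
      \<le> liminf (\<lambda>n. \<integral>\<^sup>+ \<omega>. ennreal (tail_h (a (q n)) (u n \<omega>)) \<partial>M)"
    unfolding u_def by (intro nn_integral_liminf) measurable
  also have "\<dots> \<le> liminf (\<lambda>n. w)"
    using l(2) by (intro Liminf_mono always_eventually)
      (auto simp: u_def q_def tail_mean_def intro: less_imp_le)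
  also have "\<dots> = w"
    by (simp add: Liminf_const)
  finally have Fatou: "(\<integral>\<^sup>+ \<omega>. liminf (\<lambda>n. ennreal (tail_h (a (q n)) (u n \<omega>))) \<partial>M) \<le> w" .
  have L: "0 \<le> L"
    using l(1) by (intro LIMSEQ_le_const[OF s(2)]) (auto intro: less_imp_le)
  show False
  proof (cases L)
    case (real l')
    with s(2) have l': "(\<lambda>n. l (s n)) \<longlonglongrightarrow> l'"
      by (simp add: comp_def)
    have "tail_mean \<alpha> M X x l' = (\<integral>\<^sup>+ \<omega>. liminf (\<lambda>n. ennreal (tail_h (a (q n)) (u n \<omega>))) \<partial>M)"
      unfolding tail_mean_def
    proof (rule nn_integral_cong_AE)
      show "AE \<omega> in M. ennreal (tail_h \<alpha> (l' * (X \<omega> - x))) = liminf (\<lambda>n. ennreal (tail_h (a (q n)) (u n \<omega>)))"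
        using Y
      proof eventually_elim
        case (elim \<omega>)
        have "(\<lambda>n. u n \<omega>) \<longlonglongrightarrow> l' * (X \<omega> - x)"
          unfolding u_def by (intro tendsto_intros l' sub[OF elim] sub[OF y])
        then have "(\<lambda>n. ennreal (tail_h (a (q n)) (u n \<omega>))) \<longlonglongrightarrow> ennreal (tail_h \<alpha> (l' * (X \<omega> - x)))"
          using a(3) by (intro tendsto_ennrealI tail_h_tendsto a(1) sub[OF a(2)]) auto
        then show ?case
          by (rule lim_imp_Liminf[OF sequentially_bot, symmetric])
      qed
    qed
    with Fatou w(2) have less: "tail_mean \<alpha> M X x l' < tail_bound \<alpha> M X x"
      by simp
    show False
    proof (cases "l' = 0")
      case True
      with less le_1 show False
        by (simp add: tail_mean_def emeasure_space_1)
    next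
      case False
      with L real have "0 < l'" by simp
      with less show False
        using tail_bound_le[of l' \<alpha> M X x] by simp
    qed
  next
    case PInf
    with s(2) have l': "filterlim (\<lambda>n. l (s n)) at_top sequentially"
      by (simp add: comp_def tendsto_PInfty_eq_at_top)
    \<comment> \<open>On X > x the arguments u n tend to \<infinity>, so the lower limit of the
      integrand is \<infinity> there; by \<open>exceeds\<close> this event has positive
      probability.\<close>
    have "(\<integral>\<^sup>+ \<omega>. \<top> * indicator {\<omega> \<in> space M. x < X \<omega>} \<omega> \<partial>M)
        \<le> (\<integral>\<^sup>+ \<omega>. liminf (\<lambda>n. ennreal (tail_h (a (q n)) (u n \<omega>))) \<partial>M)"
    proof (rule nn_integral_mono_AE)
      show "AE \<omega> in M. \<top> * indicator {\<omega> \<in> space M. x < X \<omega>} \<omega>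
          \<le> liminf (\<lambda>n. ennreal (tail_h (a (q n)) (u n \<omega>)))"
        using Y
      proof eventually_elim
        case (elim \<omega>)
        show ?case
        proof (cases "x < X \<omega>")
          case True
          have "(\<lambda>n. Y (q n) \<omega> - y (q n)) \<longlonglongrightarrow> X \<omega> - x"
            by (intro tendsto_intros sub[OF elim] sub[OF y])
          then have "filterlim (\<lambda>n. u n \<omega>) at_top sequentially"
            unfolding u_def using True l'
            by (subst mult.commute, intro filterlim_tendsto_pos_mult_at_top[where c = "X \<omega> - x"]) auto
          then show ?thesis
            by (simp add: liminf_tail_h_at_top[OF a(1) sub[OF a(2)]])
        qed auto
      qed
    qed
    moreover have "(\<integral>\<^sup>+ \<omega>. \<top> * indicator {\<omega> \<in> space M. x < X \<omega>} \<omega> \<partial>M) = \<top>"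
      using exceeds AE_iff_measurable[of "{\<omega> \<in> space M. x < X \<omega>}" M "\<lambda>\<omega>. X \<omega> \<le> x"]
      by (subst nn_integral_cmult_indicator) (auto simp: ennreal_top_mult not_le)
    ultimately have "w = \<top>"
      using Fatou by (metis top.extremum_unique order.trans)
    with w(2) show False by simp
  next
    case MInf
    with L show False by simp
  qed
qed

text \<open>The bound is at most each mean, so convergence from above can be checked for one l at a
  time. Restricting to l with finite limit mean is what makes dominating functions available and,
  for \<alpha> = \<infinity>, uniform integrability.\<close>

lemma limsup_tail_bound_le:
  assumes "\<And>l. 0 < l \<Longrightarrow> tail_mean \<alpha> M X x l < \<infinity> \<Longrightarrow>
      limsup (\<lambda>n. tail_mean (a n) (N n) (Y n) (y n) l) \<le> tail_mean \<alpha> M X x l"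
  shows "limsup (\<lambda>n. tail_bound (a n) (N n) (Y n) (y n)) \<le> tail_bound \<alpha> M X x"
  unfolding tail_bound_eq_INF[of \<alpha>]
proof (rule INF_greatest)
  fix l :: real
  assume "l \<in> {0<..}"
  then have l: "0 < l" by simp
  show "limsup (\<lambda>n. tail_bound (a n) (N n) (Y n) (y n)) \<le> tail_mean \<alpha> M X x l"
  proof (cases "tail_mean \<alpha> M X x l < \<infinity>")
    case True
    have "limsup (\<lambda>n. tail_bound (a n) (N n) (Y n) (y n)) \<le> limsup (\<lambda>n. tail_mean (a n) (N n) (Y n) (y n) l)"
      by (intro Limsup_mono always_eventually allI tail_bound_le l)
    with assms[OF l True] show ?thesis
      by (rule order.trans[rotated])
  qed (simp add: not_less top_unique)
qed

lemma tendsto_of_liminf_limsup: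
  fixes f :: "nat \<Rightarrow> ennreal"
  assumes "c \<le> liminf f" "limsup f \<le> c"
  shows "f \<longlonglongrightarrow> c"
  using assms Liminf_le_Limsup[of sequentially f]
  by (intro Liminf_eq_Limsup) (auto intro: antisym order.trans)

text \<open>\<open>no_atom\<close> leaves two cases for the lower half: the bound at x is 0, or X >
  x has positive probability and the Fatou lemma applies.\<close>

lemma tail_bound_tendsto_point:
  assumes "prob_space M" and X: "X \<in> rv_class \<alpha> M" and "0 < \<alpha>" and y: "y \<longlonglongrightarrow> x"
    and no_atom: "\<not> ((AE \<omega> in M. X \<omega> \<le> x) \<and> tail_bound \<alpha> M X x \<noteq> 0)"
  shows "(\<lambda>n. tail_bound \<alpha> M X (y n)) \<longlonglongrightarrow> tail_bound \<alpha> M X x"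
proof (rule tendsto_of_liminf_limsup)
  note [measurable] = rv_class_measurable[OF X]
  show "tail_bound \<alpha> M X x \<le> liminf (\<lambda>n. tail_bound \<alpha> M X (y n))"
  proof (cases "AE \<omega> in M. X \<omega> \<le> x")
    case False
    then show ?thesis
      using assms by (intro tail_bound_le_liminf tail_bound_le_1) (auto simp: rv_class_measurable)
  qed (use no_atom in simp)
  show "limsup (\<lambda>n. tail_bound \<alpha> M X (y n)) \<le> tail_bound \<alpha> M X x"
  proof (rule limsup_tail_bound_le)
    fix l :: real
    assume l: "0 < l" and fin: "tail_mean \<alpha> M X x l < \<infinity>"
    \<comment> \<open>A lower bound b of the points gives a dominating function, since the integrand
      decreases in the point. Its mean is finite: for finite \<alpha> every mean is, and at
      \<infinity> finiteness depends on l alone.\<close>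
    obtain b where b: "\<And>n. b \<le> y n"
    proof -
      obtain K where K: "\<And>n. \<bar>y n\<bar> \<le> K"
        using y convergent_imp_Bseq[of y] by (auto simp: convergent_def Bseq_def)
      then show thesis
        by (intro that[of "- K"]) (simp add: abs_le_iff minus_le_iff)
    qed
    have fin_b: "tail_mean \<alpha> M X b l < \<infinity>"
    proof (cases \<alpha> rule: ennreal_param_cases)
      case zero
      with \<open>0 < \<alpha>\<close> show ?thesis by simp
    next
      case (real c)
      then show ?thesis
        using tail_mean_finite_real[OF assms(1), of X c l b] X l by simp
    next
      case top
      then show ?thesis
        using fin by (simp add: tail_mean_top ennreal_mult_less_top ennreal_eq_0_iff not_le)
    qed
    have "(\<lambda>n. tail_mean \<alpha> M X (y n) l) \<longlonglongrightarrow> tail_mean \<alpha> M X x l"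
      unfolding tail_mean_def
    proof (rule nn_integral_dominated_convergence[where w = "\<lambda>\<omega>. ennreal (tail_h \<alpha> (l * (X \<omega> - b)))"])
      show "AE \<omega> in M. ennreal (tail_h \<alpha> (l * (X \<omega> - y n))) \<le> ennreal (tail_h \<alpha> (l * (X \<omega> - b)))" for n
        using b[of n] l by (intro AE_I2 ennreal_leI tail_h_mono) auto
      show "AE \<omega> in M. (\<lambda>n. ennreal (tail_h \<alpha> (l * (X \<omega> - y n)))) \<longlonglongrightarrow> ennreal (tail_h \<alpha> (l * (X \<omega> - x)))"
        using \<open>0 < \<alpha>\<close> y by (intro AE_I2 tendsto_ennrealI tail_h_tendsto tendsto_intros) auto
    qed (use fin_b in \<open>auto simp: tail_mean_def\<close>)
    from lim_imp_Limsup[OF sequentially_bot this]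
    show "limsup (\<lambda>n. tail_mean \<alpha> M X (y n) l) \<le> tail_mean \<alpha> M X x l"
      by simp
  qed
qed

section \<open>Stability in the parameter\<close>

lemma SUP_finite_of_tendsto:
  fixes a :: "nat \<Rightarrow> ennreal"
  assumes "a \<longlonglongrightarrow> \<alpha>" "\<alpha> < \<infinity>" "\<And>n. a n < \<infinity>"
  shows "(SUP n. a n) < \<infinity>"
proof -
  obtain b where b: "\<alpha> < b" "b < \<infinity>"
    using dense[OF assms(2)] by blast
  obtain k where k: "\<And>n. k \<le> n \<Longrightarrow> a n < b"
    using order_tendstoD(2)[OF assms(1) b(1)] by (auto simp: eventually_sequentially)
  have "a n \<le> max b (Max (insert 0 (a ` {..<k})))" for n
    by (cases "k \<le> n") (auto simp: le_max_iff_disj not_le less_imp_le[OF k] intro!: Max_ge)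
  then have "(SUP n. a n) \<le> max b (Max (insert 0 (a ` {..<k})))"
    by (intro SUP_least)
  also have "\<dots> < \<infinity>"
    using b(2) assms(3) by auto
  finally show ?thesis .
qed

text \<open>Here u is fixed, since \<open>tail_h 0\<close> jumps at 0. For u < 0 the values vanish
  once the parameter is below - u; for u \<ge> 0 they are squeezed to 1.\<close>

lemma tail_h_tendsto_0:
  assumes a: "a \<longlonglongrightarrow> 0" "\<And>n. a n < \<infinity>"
  shows "(\<lambda>n. tail_h (a n) u) \<longlonglongrightarrow> tail_h 0 u"
proof (cases "0 \<le> u")
  case True
  have "(\<lambda>n. enn2real (a n)) \<longlonglongrightarrow> 0"
    using tendsto_enn2real[of a 0 sequentially] a by simp
  then have "(\<lambda>n. exp (2 * sqrt (u * enn2real (a n)))) \<longlonglongrightarrow> exp (2 * sqrt (u * 0))"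
    by (intro tendsto_exp tendsto_mult_left tendsto_real_sqrt)
  then have lim: "(\<lambda>n. exp (2 * sqrt (u * enn2real (a n)))) \<longlonglongrightarrow> 1"
    by simp
  have "(\<lambda>n. tail_h (a n) u) \<longlonglongrightarrow> 1"
    by (rule tendsto_sandwich[OF _ _ tendsto_const lim])
       (use True a tail_h_upper_small tail_h_ge_1 in auto)
  with True show ?thesis by (simp add: tail_h_0)
next
  case False
  have "\<forall>\<^sub>F n in sequentially. a n < ennreal (- u)"
    using a False by (intro order_tendstoD) auto
  then have "\<forall>\<^sub>F n in sequentially. tail_h (a n) u = tail_h 0 u"
  proof eventually_elim
    case (elim n)
    show ?case
    proof (cases "a n" rule: ennreal_param_cases)
      case (real b)
      with elim False have "b < - u"
        by (simp add: ennreal_less_iff)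
      with real have "1 + u / b < 0"
        by (simp add: field_simps)
      with real False show ?thesis
        by (simp add: tail_h_ennreal tail_h_0)
    qed (use elim in simp_all)
  qed
  then show ?thesis
    by (rule tendsto_eventually)
qed

text \<open>If \<alpha> = 0 or X \<le> x almost surely, the limit equals the bound at parameter 0,
  which is below every term; otherwise the Fatou lemma applies. For the upper half the integrand at
  the supremum \<beta> dominates.\<close>

lemma tail_bound_tendsto_param:
  assumes "prob_space M" and X: "X \<in> rv_class \<alpha> M" and a: "\<And>n. a n < \<infinity>" "a \<longlonglongrightarrow> \<alpha>"
    and \<beta>: "\<beta> = (SUP n. a n)" and sup: "X \<in> rv_class \<beta> M"
  shows "(\<lambda>n. tail_bound (a n) M X x) \<longlonglongrightarrow> tail_bound \<alpha> M X x"
proof (rule tendsto_of_liminf_limsup)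
  note [measurable] = rv_class_measurable[OF X]
  show "tail_bound \<alpha> M X x \<le> liminf (\<lambda>n. tail_bound (a n) M X x)"
  proof (cases "\<alpha> = 0 \<or> (AE \<omega> in M. X \<omega> \<le> x)")
    case True
    have "tail_bound \<alpha> M X x \<le> tail_bound (a n) M X x" for n
    proof -
      have "tail_bound \<alpha> M X x = tail_bound 0 M X x"
        using True by (auto intro: tail_bound_eq_tail_bound_0[OF \<open>prob_space M\<close>])
      then show ?thesis
        by (simp add: tail_bound_mono_param)
    qed
    then show ?thesis
      by (intro Liminf_bounded) auto
  next
    case False
    then show ?thesis
      using assms by (intro tail_bound_le_liminf tail_bound_le_1) (auto simp: rv_class_measurable zero_less_iff_neq_zero)
  qed
  have upper: "a n \<le> \<beta>" for n
    unfolding \<beta> by (rule SUP_upper) simp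
  show "limsup (\<lambda>n. tail_bound (a n) M X x) \<le> tail_bound \<alpha> M X x"
  proof (rule limsup_tail_bound_le)
    fix l :: real
    assume l: "0 < l" and fin: "tail_mean \<alpha> M X x l < \<infinity>"
    \<comment> \<open>If \<alpha> = \<infinity> then \<beta> = \<infinity> too, and this is the
      assumed finiteness at l. If \<alpha> < \<infinity> then \<beta> < \<infinity>, where
      membership in the class of \<beta> makes every mean finite.\<close>
    have fin_sup: "tail_mean \<beta> M X x l < \<infinity>"
    proof (cases "\<alpha> = \<infinity>")
      case True
      have "\<alpha> \<le> \<beta>"
        using a(2) upper by (intro LIMSEQ_le_const2) auto
      with True have "\<beta> = \<alpha>"
        by (simp add: top_unique)
      with fin show ?thesis by simp
    next
      case False
      then have "\<beta> < \<infinity>"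
        unfolding \<beta> using a by (intro SUP_finite_of_tendsto) (auto simp: less_top)
      then show ?thesis
        using l sup tail_mean_finite_real[OF assms(1)]
        by (cases \<beta> rule: ennreal_param_cases)
          (auto intro: order.strict_trans1[OF tail_mean_0_le_1[OF assms(1)]])
    qed
    have "(\<lambda>n. tail_mean (a n) M X x l) \<longlonglongrightarrow> tail_mean \<alpha> M X x l"
      unfolding tail_mean_def
    proof (rule nn_integral_dominated_convergence[where w = "\<lambda>\<omega>. ennreal (tail_h \<beta> (l * (X \<omega> - x)))"])
      show "AE \<omega> in M. ennreal (tail_h (a n) (l * (X \<omega> - x))) \<le> ennreal (tail_h \<beta> (l * (X \<omega> - x)))" for n
        by (intro AE_I2 ennreal_leI tail_h_mono_param upper)
      have "(\<lambda>n. tail_h (a n) u) \<longlonglongrightarrow> tail_h \<alpha> u" for u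
        using a tail_h_tendsto_0[of a u] tail_h_tendsto[of \<alpha> a "\<lambda>_. u" u]
        by (cases "\<alpha> = 0") (auto simp: zero_less_iff_neq_zero)
      then show "AE \<omega> in M. (\<lambda>n. ennreal (tail_h (a n) (l * (X \<omega> - x)))) \<longlonglongrightarrow> ennreal (tail_h \<alpha> (l * (X \<omega> - x)))"
        by (intro AE_I2 tendsto_ennrealI)
    qed (use fin_sup in \<open>auto simp: tail_mean_def\<close>)
    from lim_imp_Limsup[OF sequentially_bot this]
    show "limsup (\<lambda>n. tail_mean (a n) M X x l) \<le> tail_mean \<alpha> M X x l"
      by simp
  qed
qed

subsection \<open>The supremum of the support\<close>

text \<open>The complement of the support is a union of countably many open null sets.\<close>

lemma AE_le_iff_distr_support:
  assumes "prob_space M" and X [measurable]: "X \<in> borel_measurable M"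
  shows "(AE \<omega> in M. X \<omega> \<le> x) \<longleftrightarrow> distr_support M X \<subseteq> {..x}"
proof
  assume AE: "AE \<omega> in M. X \<omega> \<le> x"
  show "distr_support M X \<subseteq> {..x}"
  proof
    fix y
    assume y: "y \<in> distr_support M X"
    have "emeasure (distr M borel X) {x<..} = emeasure M {\<omega> \<in> space M. \<not> X \<omega> \<le> x}"
      by (subst emeasure_distr) (auto intro!: arg_cong[where f = "emeasure M"])
    also have "\<dots> = 0"
      using AE by (subst AE_iff_measurable[symmetric, where P = "\<lambda>\<omega>. X \<omega> \<le> x"]) auto
    finally have "\<not> 0 < emeasure (distr M borel X) {x<..}"
      by simp
    then have "y \<notin> {x<..}"
      using y open_greaterThan[of x] unfolding distr_support_def by blast
    then show "y \<in> {..x}"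
      by simp
  qed
next
  assume supp: "distr_support M X \<subseteq> {..x}"
  define \<U> where "\<U> = {U. open U \<and> emeasure (distr M borel X) U = 0}"
  obtain \<V> where \<V>: "\<V> \<subseteq> \<U>" "countable \<V>" "\<Union>\<V> = \<Union>\<U>"
    using Lindelof[of \<U>] by (auto simp: \<U>_def)
  have "V \<in> null_sets (distr M borel X)" if "V \<in> \<V>" for V
    using that \<V>(1) by (auto simp: \<U>_def null_sets_def)
  then have null: "\<Union>\<V> \<in> null_sets (distr M borel X)"
    using \<V>(2) null_sets_UN'[of \<V> "\<lambda>V. V"] by simp
  have "{u \<in> space (distr M borel X). \<not> u \<le> x} \<subseteq> {x<..}"
    by auto
  also have "{x<..} \<subseteq> \<Union>\<V>"
  proof
    fix z
    assume "z \<in> {x<..}"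
    with supp have "z \<notin> distr_support M X"
      by auto
    then obtain U where "open U" "z \<in> U" "\<not> 0 < emeasure (distr M borel X) U"
      unfolding distr_support_def by blast
    then have "U \<in> \<U>"
      by (simp add: \<U>_def zero_less_iff_neq_zero)
    with \<open>z \<in> U\<close> show "z \<in> \<Union>\<V>"
      unfolding \<V>(3) by blast
  qed
  finally have "AE u in distr M borel X. u \<le> x"
    by (rule AE_I'[OF null])
  then show "AE \<omega> in M. X \<omega> \<le> x"
    by (simp add: AE_distr_iff)
qed

text \<open>Restates the exceptional condition in the form in which semicontinuity meets it. Any
  \<alpha> will do, because with X \<le> x almost surely the bound equals the probability of X =
  x.\<close>

lemma at_atom_iff:
  assumes "prob_space M" and X [measurable]: "X \<in> borel_measurable M"
  shows "ereal x = x_star M X \<and> 0 < p_star M X \<longleftrightarrow>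
      (AE \<omega> in M. X \<omega> \<le> x) \<and> tail_bound \<alpha> M X x \<noteq> 0"
proof -
  interpret prob_space M by fact
  have prob: "tail_bound \<alpha> M X x = ennreal (prob {\<omega> \<in> space M. X \<omega> = x})" if AE: "AE \<omega> in M. X \<omega> \<le> x"
  proof -
    have "tail_bound \<alpha> M X x = emeasure M {\<omega> \<in> space M. x \<le> X \<omega>}"
      using tail_bound_eq_tail_bound_0[OF assms AE] by (simp add: tail_bound_0)
    also have "\<dots> = emeasure M {\<omega> \<in> space M. X \<omega> = x}"
      using AE by (intro emeasure_eq_AE) auto
    finally show ?thesis
      by (simp add: emeasure_eq_measure)
  qed
  have x_star_le: "x_star M X \<le> ereal x" if "AE \<omega> in M. X \<omega> \<le> x"
    using that AE_le_iff_distr_support[OF assms] by (auto simp: x_star_def intro!: SUP_least)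
  show ?thesis
  proof
    assume L: "ereal x = x_star M X \<and> 0 < p_star M X"
    have "ereal y \<le> ereal x" if "y \<in> distr_support M X" for y
      using that L SUP_upper[of y "distr_support M X" ereal] by (simp add: x_star_def)
    then have AE: "AE \<omega> in M. X \<omega> \<le> x"
      by (auto simp: AE_le_iff_distr_support[OF assms])
    have "p_star M X = prob {\<omega> \<in> space M. X \<omega> = x}"
      unfolding p_star_def using L by (metis ereal.inject)
    with L AE prob[OF AE] show "(AE \<omega> in M. X \<omega> \<le> x) \<and> tail_bound \<alpha> M X x \<noteq> 0"
      by (simp add: ennreal_eq_0_iff not_le)
  next
    assume R: "(AE \<omega> in M. X \<omega> \<le> x) \<and> tail_bound \<alpha> M X x \<noteq> 0"
    then have pos: "0 < prob {\<omega> \<in> space M. X \<omega> = x}"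
      using prob by (simp add: ennreal_eq_0_iff not_le)
    \<comment> \<open>Every neighbourhood of x carries at least the mass of the atom.\<close>
    have "x \<in> distr_support M X"
      unfolding distr_support_def
    proof safe
      fix U :: "real set"
      assume U: "open U" "x \<in> U"
      have "0 < emeasure M {\<omega> \<in> space M. X \<omega> = x}"
        using pos by (simp add: emeasure_eq_measure)
      also have "\<dots> \<le> emeasure (distr M borel X) U"
        using U by (subst emeasure_distr) (auto intro!: emeasure_mono)
      finally show "0 < emeasure (distr M borel X) U" .
    qed
    then have "ereal x \<le> x_star M X"
      unfolding x_star_def by (rule SUP_upper)
    with x_star_le R have eq: "ereal x = x_star M X"
      by (simp add: antisym)
    then have "p_star M X = prob {\<omega> \<in> space M. X \<omega> = x}"
      unfolding p_star_def by (metis ereal.inject)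
    with eq pos show "ereal x = x_star M X \<and> 0 < p_star M X"
      by simp
  qed
qed

text \<open>The exception is genuine: right of an atom at \<open>x_star\<close> the bound is 0,
  while at the atom it is positive.\<close>

lemma isCont_tail_bound_iff:
  assumes "prob_space M" and X: "X \<in> rv_class \<alpha> M" and "0 < \<alpha>"
  shows "isCont (tail_bound \<alpha> M X) x \<longleftrightarrow> \<not> (ereal x = x_star M X \<and> 0 < p_star M X)"
  unfolding at_atom_iff[OF assms(1) rv_class_measurable[OF X], of x \<alpha>]
proof
  assume "\<not> ((AE \<omega> in M. X \<omega> \<le> x) \<and> tail_bound \<alpha> M X x \<noteq> 0)"
  then show "isCont (tail_bound \<alpha> M X) x"
    using tail_bound_tendsto_point[OF assms]
    by (auto simp: isCont_def tendsto_at_iff_sequentially comp_def)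
next
  assume cont: "isCont (tail_bound \<alpha> M X) x"
  show "\<not> ((AE \<omega> in M. X \<omega> \<le> x) \<and> tail_bound \<alpha> M X x \<noteq> 0)"
  proof
    assume R: "(AE \<omega> in M. X \<omega> \<le> x) \<and> tail_bound \<alpha> M X x \<noteq> 0"
    interpret prob_space M by fact
    note [measurable] = rv_class_measurable[OF X]
    have zero: "tail_bound \<alpha> M X y = 0" if "x < y" for y
    proof -
      have "tail_bound \<alpha> M X y = emeasure M {\<omega> \<in> space M. y \<le> X \<omega>}"
        using R that by (subst tail_bound_eq_tail_bound_0[OF assms(1)]) (auto simp: tail_bound_0)
      also have "\<dots> = emeasure M {}"
        using R that by (intro emeasure_eq_AE) auto
      finally show ?thesis by simp
    qed
    have "(tail_bound \<alpha> M X \<longlongrightarrow> tail_bound \<alpha> M X x) (at_right x)"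
      using cont by (auto simp: isCont_def intro: tendsto_within_subset)
    moreover have "(tail_bound \<alpha> M X \<longlongrightarrow> 0) (at_right x)"
      by (rule tendsto_eventually) (auto simp: eventually_at_filter zero)
    ultimately show False
      using R tendsto_unique[OF trivial_limit_at_right_real] by blast
  qed
qed

subsection \<open>Concavity in \<open>x\<close>\<close>

lemma tail_bound_real_cases:
  assumes "prob_space M" "X \<in> rv_class \<alpha> M"
  obtains p where "0 \<le> p" "p \<le> 1" "tail_bound \<alpha> M X x = ennreal p"
  using tail_bound_le_1[OF assms, of x]
  by (cases "tail_bound \<alpha> M X x") (auto simp: top_unique)

lemma neg_power_ennreal: "0 < p \<Longrightarrow> neg_power (ennreal p) a = ereal (p powr (- a))"
  by (auto simp: neg_power_def ennreal_eq_0_iff)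

text \<open>
  With \<open>t = y - a / l\<close>, the mean at \<open>y\<close> is \<open>(E (X - t)\<^sub>+\<^sup>a) / (y - t)\<^sup>a\<close>; hence a lower bound \<open>b powr (- a)\<close>
  for the tail bound at \<open>y\<close> says that \<open>(y - t) / b\<close> is at most the \<open>a\<close>-norm of \<open>(X - t)\<^sub>+\<close>, for all \<open>t\<close>,
  and this is affine in \<open>y\<close> and \<open>b\<close>.
\<close>

lemma tail_mean_ennreal:
  assumes "0 < a" "t < y"
  shows "tail_mean (ennreal a) M X y (a / (y - t)) =
    (\<integral>\<^sup>+ \<omega>. ennreal (max 0 (X \<omega> - t) powr a / (y - t) powr a) \<partial>M)"
proof -
  have "max 0 (1 + a / (y - t) * (u - y) / a) = max 0 (u - t) / (y - t)" for u
    using assms by (simp add: field_simps max_def)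
  then show ?thesis
    using assms unfolding tail_mean_def by (simp add: tail_h_ennreal powr_divide)
qed

lemma tail_mean_ennreal_eq:
  assumes "0 < a" "t < y" and [measurable]: "X \<in> borel_measurable M"
    and E: "(\<integral>\<^sup>+ \<omega>. ennreal (max 0 (X \<omega> - t) powr a) \<partial>M) = ennreal E" "0 \<le> E"
  shows "tail_mean (ennreal a) M X y (a / (y - t)) = ennreal (E / (y - t) powr a)"
proof -
  have "tail_mean (ennreal a) M X y (a / (y - t))
      = (\<integral>\<^sup>+ \<omega>. ennreal (max 0 (X \<omega> - t) powr a) * ennreal (1 / (y - t) powr a) \<partial>M)"
    unfolding tail_mean_ennreal[OF assms(1,2)] by (simp flip: ennreal_mult)
  also have "\<dots> = ennreal (E / (y - t) powr a)"
    using E by (subst nn_integral_multc) (auto simp flip: ennreal_mult)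
  finally show ?thesis .
qed

lemma neg_power_tail_bound_convex:
  assumes "prob_space M" and X: "X \<in> rv_class (ennreal a) M" and a: "0 < a"
  shows "ereal_convex (\<lambda>y. neg_power (tail_bound (ennreal a) M X y) (1 / a))"
  unfolding ereal_convex_def
proof (intro conjI allI impI)
  let ?P = "tail_bound (ennreal a) M X"
  let ?f = "\<lambda>y. neg_power (?P y) (1 / a)"
  note [measurable] = rv_class_measurable[OF X]
  show "?f y \<noteq> - \<infinity>" for y
    by (simp add: neg_power_def)
  have nonneg: "0 \<le> ?f y" for y
    by (simp add: neg_power_def)
  fix y z u v :: real
  assume uv: "0 \<le> u" "0 \<le> v" "u + v = 1"
  define w where "w = u * y + v * z"
  obtain p where p: "0 \<le> p" "?P y = ennreal p"
    by (rule tail_bound_real_cases[OF assms(1) X]) blast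
  obtain q where q: "0 \<le> q" "?P z = ennreal q"
    by (rule tail_bound_real_cases[OF assms(1) X]) blast
  consider "u = 0" | "v = 0" | "0 < u" "0 < v" "p = 0 \<or> q = 0" | "0 < u" "0 < v" "0 < p" "0 < q"
    using uv p q by fastforce
  then show "?f (u * y + v * z) \<le> ereal u * ?f y + ereal v * ?f z"
  proof cases
    case 3
    then have "ereal u * ?f y + ereal v * ?f z = \<infinity>"
      using p q nonneg[of y] nonneg[of z] by (auto simp: neg_power_def)
    then show ?thesis by (simp only: ereal_less_eq)
  next
    case 4
    \<comment> \<open>b and c are the transformed bounds at y and z, and d is the value of the chord
      at w. It suffices that d powr (- a) is below every mean at w.\<close>
    define b where "b = p powr (- (1 / a))"
    define c where "c = q powr (- (1 / a))"
    define d where "d = u * b + v * c"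
    have bc: "0 < b" "0 < c" "p = b powr (- a)" "q = c powr (- a)"
      using 4 a by (auto simp: b_def c_def powr_powr)
    have d: "0 < d"
      using 4 bc by (simp add: d_def add_pos_pos)
    \<comment> \<open>t will range below w, hence may exceed one of y and z; there the left-hand
      side is not positive.\<close>
    have bound: "y' - t \<le> b' * E powr (1 / a)"
      if E: "(\<integral>\<^sup>+ \<omega>. ennreal (max 0 (X \<omega> - t) powr a) \<partial>M) = ennreal E" "0 \<le> E"
        and b': "0 < b'" "?P y' = ennreal (b' powr (- a))" for t E y' b'
    proof (cases "t < y'")
      case True
      have "ennreal (b' powr (- a)) \<le> tail_mean (ennreal a) M X y' (a / (y' - t))"
        using tail_bound_le[of "a / (y' - t)" "ennreal a" M X y'] True a b' by simp
      also have "\<dots> = ennreal (E / (y' - t) powr a)"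
        by (rule tail_mean_ennreal_eq[OF a True _ E]) measurable
      finally have "b' powr (- a) \<le> E / (y' - t) powr a"
        using E True by (simp add: ennreal_le_iff)
      then have "(y' - t) powr a \<le> b' powr a * E"
        using True b' by (simp add: powr_minus field_simps)
      then have "((y' - t) powr a) powr (1 / a) \<le> (b' powr a * E) powr (1 / a)"
        using a by (intro powr_mono2) auto
      then show ?thesis
        using True a b' E by (simp add: powr_powr powr_mult)
    next
      case False
      then show ?thesis
        using b' by (auto intro: order.trans[of "y' - t" 0])
    qed
    have "ennreal (d powr (- a)) \<le> ?P w"
      unfolding tail_bound_eq_INF
    proof (rule INF_greatest)
      fix l :: real
      assume "l \<in> {0<..}"
      then have l: "0 < l" by simp
      define t where "t = w - a / l"
      have t: "t < w" "l = a / (w - t)"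
        using a l by (auto simp: t_def)
      show "ennreal (d powr (- a)) \<le> tail_mean (ennreal a) M X w l"
      proof (cases "\<integral>\<^sup>+ \<omega>. ennreal (max 0 (X \<omega> - t) powr a) \<partial>M")
        case (real E)
        have "w - t = w - (u + v) * t"
          using uv by simp
        also have "\<dots> = u * (y - t) + v * (z - t)"
          by (simp add: w_def algebra_simps)
        also have "\<dots> \<le> u * (b * E powr (1 / a)) + v * (c * E powr (1 / a))"
          using 4 bc p q by (intro add_mono mult_left_mono bound[OF real(2) real(1)]) auto
        also have "\<dots> = d * E powr (1 / a)"
          by (simp add: d_def algebra_simps)
        finally have "(w - t) powr a \<le> (d * E powr (1 / a)) powr a"
          using a t by (intro powr_mono2) auto
        also have "\<dots> = d powr a * E"
          using a d real by (simp add: powr_mult powr_powr)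
        finally have "d powr (- a) \<le> E / (w - t) powr a"
          using t d by (simp add: powr_minus field_simps)
        then show ?thesis
          using tail_mean_ennreal_eq[OF a t(1) _ real(2) real(1)] t(2) by (simp add: ennreal_leI)
      next
        case top
        have "tail_mean (ennreal a) M X w l = (\<integral>\<^sup>+ \<omega>. ennreal (max 0 (X \<omega> - t) powr a) * ennreal (1 / (w - t) powr a) \<partial>M)"
          unfolding t(2) tail_mean_ennreal[OF a t(1)] by (simp flip: ennreal_mult)
        also have "\<dots> = \<top>"
          using top t by (subst nn_integral_multc) (auto simp: ennreal_top_mult)
        finally show ?thesis by simp
      qed
    qed
    moreover obtain s where s: "0 \<le> s" "?P w = ennreal s"
      by (rule tail_bound_real_cases[OF assms(1) X]) blast
    ultimately have s_ge: "d powr (- a) \<le> s"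
      by (simp add: ennreal_le_iff)
    then have "0 < s"
      using d by (metis less_le_trans powr_gt_zero less_irrefl)
    have "s powr (- (1 / a)) \<le> (d powr (- a)) powr (- (1 / a))"
      using s_ge d a by (intro powr_mono2') auto
    also have "\<dots> = d"
      using d a by (simp add: powr_powr)
    finally show ?thesis
      using 4 p q s \<open>0 < s\<close> by (simp add: neg_power_ennreal d_def b_def c_def w_def[symmetric])
  qed (use uv in \<open>auto simp: zero_ereal_def[symmetric]\<close>)
qed

lemma ext_ln_ennreal: "0 < p \<Longrightarrow> ext_ln (ennreal p) = ereal (ln p)"
  by (auto simp: ext_ln_def ennreal_eq_0_iff)

text \<open>No change of variable is needed here: ln of the mean is ln E - l * y, with E the
  exponential moment of X at l, hence affine in y, and an infimum of affine functions is
  concave.\<close>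

lemma ext_ln_tail_bound_concave:
  assumes "prob_space M" and X: "X \<in> rv_class \<top> M"
  shows "ereal_concave (\<lambda>y. ext_ln (tail_bound \<top> M X y))"
  unfolding ereal_concave_def
proof (intro conjI allI impI)
  let ?P = "tail_bound \<top> M X"
  note meas = rv_class_measurable[OF X]
  have not_top: "?P y \<noteq> \<top>" for y
    using tail_bound_le_1[OF assms, of y] by (auto simp: top_unique)
  then show "ext_ln (?P y) \<noteq> \<infinity>" for y
    by (simp add: ext_ln_def)
  fix y z u v :: real
  assume uv: "0 \<le> u" "0 \<le> v" "u + v = 1"
  define w where "w = u * y + v * z"
  obtain p where p: "0 \<le> p" "?P y = ennreal p"
    by (rule tail_bound_real_cases[OF assms]) blast
  obtain q where q: "0 \<le> q" "?P z = ennreal q"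
    by (rule tail_bound_real_cases[OF assms]) blast
  consider "u = 0" | "v = 0" | "0 < u" "0 < v" "p = 0 \<or> q = 0" | "0 < u" "0 < v" "0 < p" "0 < q"
    using uv p q by fastforce
  then show "ereal u * ext_ln (?P y) + ereal v * ext_ln (?P z) \<le> ext_ln (?P (u * y + v * z))"
  proof cases
    case 3
    then have "ereal u * ext_ln (?P y) + ereal v * ext_ln (?P z) = - \<infinity>"
      using not_top[of y] not_top[of z] p q by (auto simp: ext_ln_def)
    then show ?thesis by (simp only: ereal_less_eq)
  next
    case 4
    define d where "d = u * ln p + v * ln q"
    have bound: "ln p' + l * y' \<le> ln E"
      if "0 < l" "(\<integral>\<^sup>+ \<omega>. ennreal (exp (l * X \<omega>)) \<partial>M) = ennreal E" "0 \<le> E" "0 < p'" "?P y' = ennreal p'"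
      for l E p' y'
    proof -
      have "ennreal p' \<le> ennreal (exp (- l * y') * E)"
        using tail_bound_le[OF that(1), of \<top> M X y'] that by (simp add: tail_mean_top[OF meas] ennreal_mult)
      then have le: "p' \<le> exp (- l * y') * E"
        using that by (simp add: ennreal_le_iff)
      with that have "0 < E"
        by (cases "E = 0") auto
      then have "ln p' \<le> ln (exp (- l * y') * E)"
        using le that by (intro ln_mono) auto
      with \<open>0 < E\<close> show ?thesis
        by (simp add: ln_mult)
    qed
    have "ennreal (exp d) \<le> ?P w"
      unfolding tail_bound_eq_INF
    proof (rule INF_greatest)
      fix l :: real
      assume "l \<in> {0<..}"
      then have l: "0 < l" by simp
      show "ennreal (exp d) \<le> tail_mean \<top> M X w l"
      proof (cases "\<integral>\<^sup>+ \<omega>. ennreal (exp (l * X \<omega>)) \<partial>M")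
        case (real E)
        \<comment> \<open>An exponential moment 0 would force the bound at y to be 0, against 0 <
          p.\<close>
        have "E \<noteq> 0"
        proof
          assume "E = 0"
          then show False
            using tail_bound_le[OF l, of \<top> M X y] real p 4 by (simp add: tail_mean_top[OF meas])
        qed
        with real have "0 < E" by simp
        have "d + l * w = u * (ln p + l * y) + v * (ln q + l * z)"
          by (simp add: d_def w_def algebra_simps)
        also have "\<dots> \<le> u * ln E + v * ln E"
          using 4 p q l by (intro add_mono mult_left_mono bound[OF _ real(2) real(1)]) auto
        also have "\<dots> = ln E"
          using uv by (simp flip: distrib_right)
        finally have "d \<le> - l * w + ln E" by simp
        then have "exp d \<le> exp (- l * w) * E"
          using \<open>0 < E\<close> by (metis exp_add exp_le_cancel_iff exp_ln)
        then show ?thesis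
          using real by (simp add: tail_mean_top[OF meas] ennreal_leI flip: ennreal_mult)
      next
        case top
        then show ?thesis
          by (simp add: tail_mean_top[OF meas] ennreal_mult_top)
      qed
    qed
    moreover obtain s where s: "0 \<le> s" "?P w = ennreal s"
      by (rule tail_bound_real_cases[OF assms]) blast
    ultimately have s_ge: "exp d \<le> s"
      by (simp add: ennreal_le_iff)
    then have "0 < s"
      using less_le_trans[OF exp_gt_zero] by blast
    moreover have "d \<le> ln s"
      using s_ge \<open>0 < s\<close> by (simp add: ln_ge_iff)
    ultimately show ?thesis
      using 4 p q s by (simp add: ext_ln_ennreal d_def w_def[symmetric])
  qed (use uv in \<open>auto simp: zero_ereal_def[symmetric]\<close>)
qed

subsection \<open>Stochastic dominance\<close>

lemma dom_gen_nonneg [simp]: "0 \<le> dom_gen \<alpha> t u"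
  by (simp add: dom_gen_def)

text \<open>The case a = 0 is included: \<open>0 powr 0 = 0\<close> turns the power into the
  indicator of u > t.\<close>

lemma dom_gen_ennreal: "0 \<le> a \<Longrightarrow> dom_gen (ennreal a) t u = max 0 (u - t) powr a"
  by (auto simp: dom_gen_def max_def ennreal_eq_0_iff)

lemma dom_gen_top: "dom_gen \<top> t u = exp (u / t)"
  by (simp add: dom_gen_def)

text \<open>A point mass at t is an admissible mixing measure, so each generator belongs to the
  class it generates.\<close>

lemma stoch_dom_gen_le:
  assumes "stoch_dom \<gamma> M X N Y" "t \<in> dom_index (\<gamma> - 1)"
  shows "(\<integral>\<^sup>+ \<omega>. ennreal (dom_gen (\<gamma> - 1) t (X \<omega>)) \<partial>M) \<le> (\<integral>\<^sup>+ \<omega>. ennreal (dom_gen (\<gamma> - 1) t (Y \<omega>)) \<partial>N)"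
proof -
  let ?R = "restrict_space borel (dom_index (\<gamma> - 1)) :: real measure"
  have [measurable]: "(\<lambda>s. dom_gen (\<gamma> - 1) s u) \<in> borel_measurable ?R" for u
    by (rule measurable_restrict_space1) (unfold dom_gen_def, measurable)
  have "has_bochner_integral (return ?R t) (\<lambda>s. dom_gen (\<gamma> - 1) s u) (dom_gen (\<gamma> - 1) t u)" for u
    using assms(2)
    by (intro has_bochner_integral_nn_integral) (auto simp: nn_integral_return space_restrict_space)
  then have "dom_gen (\<gamma> - 1) t \<in> dom_class (\<gamma> - 1)"
    unfolding dom_class_def by (auto intro!: exI[of _ "return ?R t"])
  then show ?thesis
    using assms(1) by (auto simp: stoch_dom_def)
qed

text \<open>Tonelli's theorem: the mean of a mixture is the mixture of the means, and the weights w
  are nonnegative.\<close>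

lemma nn_integral_mixture_le:
  fixes f :: "real \<Rightarrow> real \<Rightarrow> ennreal" and w k :: "real \<Rightarrow> ennreal"
  assumes "prob_space M" "prob_space N"
    and [measurable]: "X \<in> borel_measurable M" "Y \<in> borel_measurable N"
      "case_prod f \<in> borel_measurable (borel \<Otimes>\<^sub>M borel)" "w \<in> borel_measurable borel"
    and le: "\<And>s. (\<integral>\<^sup>+ \<omega>. f s (X \<omega>) \<partial>M) \<le> (\<integral>\<^sup>+ \<omega>. f s (Y \<omega>) \<partial>N)"
    and k: "\<And>u. (\<integral>\<^sup>+ s. w s * f s u \<partial>lborel) = k u"
  shows "(\<integral>\<^sup>+ \<omega>. k (X \<omega>) \<partial>M) \<le> (\<integral>\<^sup>+ \<omega>. k (Y \<omega>) \<partial>N)"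
proof -
  have swap: "(\<integral>\<^sup>+ \<omega>. k (Z \<omega>) \<partial>L) = (\<integral>\<^sup>+ s. w s * (\<integral>\<^sup>+ \<omega>. f s (Z \<omega>) \<partial>L) \<partial>lborel)"
    if "prob_space L" and [measurable]: "Z \<in> borel_measurable L" for L :: "'c measure" and Z
  proof -
    interpret L: prob_space L by fact
    interpret pair_sigma_finite lborel L ..
    have "(\<integral>\<^sup>+ \<omega>. k (Z \<omega>) \<partial>L) = (\<integral>\<^sup>+ \<omega>. (\<integral>\<^sup>+ s. w s * f s (Z \<omega>) \<partial>lborel) \<partial>L)"
      by (simp add: k)
    also have "\<dots> = (\<integral>\<^sup>+ s. (\<integral>\<^sup>+ \<omega>. w s * f s (Z \<omega>) \<partial>L) \<partial>lborel)"
      by (rule Fubini') measurable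
    also have "\<dots> = (\<integral>\<^sup>+ s. w s * (\<integral>\<^sup>+ \<omega>. f s (Z \<omega>) \<partial>L) \<partial>lborel)"
      by (intro nn_integral_cong nn_integral_cmult) measurable
    finally show ?thesis .
  qed
  show ?thesis
    unfolding swap[OF assms(1,3)] swap[OF assms(2,4)] by (intro nn_integral_mono mult_left_mono le) auto
qed

text \<open>Shows that the kernel constants below are not 0, so that they can be cancelled from
  inequalities.\<close>

lemma nn_integral_pos_on_unit_interval:
  fixes f :: "real \<Rightarrow> ennreal"
  assumes [measurable]: "f \<in> borel_measurable borel" and pos: "\<And>r. 0 < r \<Longrightarrow> r < 1 \<Longrightarrow> 0 < f r"
  shows "(\<integral>\<^sup>+ r. f r \<partial>lborel) \<noteq> 0"
proof
  assume "(\<integral>\<^sup>+ r. f r \<partial>lborel) = 0"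
  then have "AE r in lborel. f r = 0"
    by (subst (asm) nn_integral_0_iff_AE) auto
  then have "AE r in lborel. r \<notin> {0<..<1 :: real}"
    by eventually_elim (use pos in force)
  then have "emeasure lborel {0<..<1 :: real} = 0"
    by (subst (asm) AE_iff_measurable[of "{0<..<1}"]) auto
  then show False by simp
qed

text \<open>B is the Beta integral with arguments a - b and b + 1; what matters is that it is
  positive and finite, so that it cancels later. As \<open>0 powr r = 0\<close> for every r, the
  kernel vanishes for s \<le> t even if its exponent is not positive.\<close>

lemma power_kernel:
  assumes "0 \<le> b" "b < a"
  obtains B where "B \<noteq> 0" "B \<noteq> \<top>"
    "\<And>u. (\<integral>\<^sup>+ s. ennreal (max 0 (s - t) powr (a - b - 1)) * ennreal (max 0 (u - s) powr b) \<partial>lborel)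
        = B * ennreal (max 0 (u - t) powr a)"
proof
  define f where "f r = ennreal (max 0 r powr (a - b - 1)) * ennreal (max 0 (1 - r) powr b)" for r :: real
  have [measurable]: "f \<in> borel_measurable borel"
    unfolding f_def by measurable
  define B where "B = (\<integral>\<^sup>+ r. f r \<partial>lborel)"
  show "B \<noteq> 0"
    unfolding B_def by (rule nn_integral_pos_on_unit_interval) (auto simp: f_def ennreal_zero_less_mult_iff)
  have "B \<le> (\<integral>\<^sup>+ r. ennreal (r powr (a - b - 1)) * indicator {0..1} r \<partial>lborel)"
    unfolding B_def
  proof (rule nn_integral_mono)
    fix r :: real
    have "max 0 (1 - r) powr b \<le> 1" if "0 \<le> r" "r \<le> 1"
      using that assms powr_mono2[of b "1 - r" 1] by (simp add: max_def)
    then show "f r \<le> ennreal (r powr (a - b - 1)) * indicator {0..1} r"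
      by (cases "0 \<le> r"; cases "r \<le> 1") (auto simp: f_def indicator_def simp flip: ennreal_mult intro!: ennreal_leI mult_left_le)
  qed
  also have "\<dots> = ennreal (1 powr (a - b - 1 + 1) / (a - b - 1 + 1))"
    using assms by (intro nn_integral_has_integral_lebesgue' has_integral_powr_from_0) auto
  finally show "B \<noteq> \<top>"
    by (auto simp: top_unique)
  fix u
  show "(\<integral>\<^sup>+ s. ennreal (max 0 (s - t) powr (a - b - 1)) * ennreal (max 0 (u - s) powr b) \<partial>lborel)
      = B * ennreal (max 0 (u - t) powr a)"
  proof (cases "t < u")
    case True
    define c where "c = u - t"
    have c: "0 < c" using True by (simp add: c_def)
    have scale: "max 0 (c * r) = c * max 0 r" for r
      using c by (auto simp: max_def zero_le_mult_iff)
    \<comment> \<open>The substitution s = t + c * r collects c powr (a - b - 1) * c powr b; with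
      the Jacobian c this becomes c powr a.\<close>
    have "ennreal (max 0 (t + c * r - t) powr (a - b - 1)) * ennreal (max 0 (u - (t + c * r)) powr b)
        = ennreal (c powr (a - 1)) * f r" for r
    proof -
      have "u - (t + c * r) = c * (1 - r)"
        by (simp add: c_def algebra_simps)
      then have "max 0 (t + c * r - t) powr (a - b - 1) * max 0 (u - (t + c * r)) powr b
          = (c * max 0 r) powr (a - b - 1) * (c * max 0 (1 - r)) powr b"
        by (simp add: scale)
      also have "\<dots> = (c powr (a - b - 1) * c powr b) * (max 0 r powr (a - b - 1) * max 0 (1 - r) powr b)"
        using c by (simp add: powr_mult)
      also have "c powr (a - b - 1) * c powr b = c powr (a - 1)"
        by (simp flip: powr_add)
      finally show ?thesis
        by (simp add: f_def flip: ennreal_mult)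
    qed
    then have "(\<integral>\<^sup>+ s. ennreal (max 0 (s - t) powr (a - b - 1)) * ennreal (max 0 (u - s) powr b) \<partial>lborel)
        = ennreal c * (\<integral>\<^sup>+ r. ennreal (c powr (a - 1)) * f r \<partial>lborel)"
      using c by (subst nn_integral_real_affine[where c = c and t = t]) auto
    also have "\<dots> = ennreal (c * c powr (a - 1)) * B"
      using c by (simp add: B_def nn_integral_cmult ennreal_mult mult.assoc)
    also have "c * c powr (a - 1) = c powr a"
      using c by (simp add: powr_diff)
    finally show ?thesis
      using c by (simp add: c_def mult.commute)
  next
    case False
    then have zero: "ennreal (max 0 (s - t) powr (a - b - 1)) * ennreal (max 0 (u - s) powr b) = 0" for s
      by (cases "s \<le> t") auto
    show ?thesis
      unfolding zero using False by simp
  qed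
qed

text \<open>Substituting s = u - r splits off exp (l * u) and leaves the Laplace transform of r powr
  b at l, a positive multiple of Gamma (b + 1).\<close>

lemma exp_kernel:
  assumes "0 \<le> b" "0 < l"
  obtains B where "B \<noteq> 0" "B \<noteq> \<top>"
    "\<And>u. (\<integral>\<^sup>+ s. ennreal (exp (l * s)) * ennreal (max 0 (u - s) powr b) \<partial>lborel) = B * ennreal (exp (l * u))"
proof
  define f where "f r = ennreal (exp (- l * r)) * ennreal (max 0 r powr b)" for r
  have [measurable]: "f \<in> borel_measurable borel"
    unfolding f_def by measurable
  define B where "B = (\<integral>\<^sup>+ r. f r \<partial>lborel)"
  show "B \<noteq> 0"
    unfolding B_def by (rule nn_integral_pos_on_unit_interval) (auto simp: f_def ennreal_zero_less_mult_iff)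
  \<comment> \<open>Rescaling by 1 / l turns f into a multiple of the Gamma integrand, which bounds
    B.\<close>
  have "f (inverse l * r) \<le> ennreal (inverse l powr b) * (ennreal (r powr (b + 1 - 1) / exp r) * indicator {0..} r)" for r
  proof (cases "0 \<le> r")
    case True
    then have "exp (- l * (inverse l * r)) * max 0 (inverse l * r) powr b = inverse l powr b * (r powr b / exp r)"
      using assms by (simp add: powr_mult exp_minus divide_inverse)
    then show ?thesis
      using True by (simp add: f_def flip: ennreal_mult)
  next
    case False
    then have "inverse l * r \<le> 0"
      using assms by (simp add: mult_le_0_iff)
    then show ?thesis by (simp add: f_def)
  qed
  then have "B \<le> ennreal (inverse l) * (\<integral>\<^sup>+ r. ennreal (inverse l powr b) * (ennreal (r powr (b + 1 - 1) / exp r) * indicator {0..} r) \<partial>lborel)"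
    using assms unfolding B_def
    by (subst nn_integral_real_affine[where c = "inverse l" and t = 0]) (auto intro!: mult_left_mono nn_integral_mono)
  also have "\<dots> = ennreal (inverse l) * (ennreal (inverse l powr b) * ennreal (Gamma (b + 1)))"
    using assms nn_integral_has_integral_lebesgue'[OF _ Gamma_integral_real[of "b + 1"]]
    by (subst nn_integral_cmult) auto
  finally show "B \<noteq> \<top>"
    by (auto simp: top_unique ennreal_mult_eq_top_iff)
  fix u
  have "ennreal (exp (l * (u + - 1 * r))) * ennreal (max 0 (u - (u + - 1 * r)) powr b) = ennreal (exp (l * u)) * f r" for r
    by (simp add: f_def mult.assoc[symmetric] right_diff_distrib mult_exp_exp flip: ennreal_mult)
  then have "(\<integral>\<^sup>+ s. ennreal (exp (l * s)) * ennreal (max 0 (u - s) powr b) \<partial>lborel)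
      = (\<integral>\<^sup>+ r. ennreal (exp (l * u)) * f r \<partial>lborel)"
    by (subst nn_integral_real_affine[where c = "- 1" and t = u]) auto
  also have "\<dots> = B * ennreal (exp (l * u))"
    unfolding B_def by (subst nn_integral_cmult) (auto simp: mult.commute)
  finally show "(\<integral>\<^sup>+ s. ennreal (exp (l * s)) * ennreal (max 0 (u - s) powr b) \<partial>lborel) = B * ennreal (exp (l * u))" .
qed

text \<open>
  Each generator of order \<open>\<alpha>\<close> is a mixture of generators of order \<open>\<beta> < \<alpha>\<close>, by the Beta integral for
  \<open>\<alpha> < \<infinity>\<close> and the Gamma integral for \<open>\<alpha> = \<infinity>\<close>.
\<close>

lemma dom_gen_le_mono:
  assumes M: "prob_space M" "X \<in> borel_measurable M" and N: "prob_space N" "Y \<in> borel_measurable N"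
    and "\<beta> \<le> \<alpha>" and t: "t \<in> dom_index \<alpha>"
    and le: "\<And>s. s \<in> dom_index \<beta> \<Longrightarrow>
      (\<integral>\<^sup>+ \<omega>. ennreal (dom_gen \<beta> s (X \<omega>)) \<partial>M) \<le> (\<integral>\<^sup>+ \<omega>. ennreal (dom_gen \<beta> s (Y \<omega>)) \<partial>N)"
  shows "(\<integral>\<^sup>+ \<omega>. ennreal (dom_gen \<alpha> t (X \<omega>)) \<partial>M) \<le> (\<integral>\<^sup>+ \<omega>. ennreal (dom_gen \<alpha> t (Y \<omega>)) \<partial>N)"
proof (cases "\<beta> = \<alpha>")
  case True
  with le t show ?thesis by simp
next
  case False
  note [measurable] = M(2) N(2)
  have "\<beta> \<noteq> \<top>"
    using False \<open>\<beta> \<le> \<alpha>\<close> by (auto simp: top_unique)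
  then obtain b where b: "0 \<le> b" "\<beta> = ennreal b"
    by (cases \<beta>) auto
  have le_b: "(\<integral>\<^sup>+ \<omega>. ennreal (max 0 (X \<omega> - s) powr b) \<partial>M) \<le> (\<integral>\<^sup>+ \<omega>. ennreal (max 0 (Y \<omega> - s) powr b) \<partial>N)" for s
    using le[of s] b by (simp add: dom_gen_ennreal dom_index_def)
  note mixture = nn_integral_mixture_le[OF M(1) N(1) M(2) N(2) _ _ le_b]
  show ?thesis
  proof (cases "\<alpha> = \<top>")
    case True
    have l: "0 < 1 / t"
      using t True by (simp add: dom_index_def)
    obtain B where B: "B \<noteq> 0" "B \<noteq> \<top>" "\<And>u. (\<integral>\<^sup>+ s. ennreal (exp (1 / t * s)) * ennreal (max 0 (u - s) powr b) \<partial>lborel)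
        = B * ennreal (exp (1 / t * u))"
      using exp_kernel[OF b(1) l] by blast
    have "(\<integral>\<^sup>+ \<omega>. B * ennreal (exp (1 / t * X \<omega>)) \<partial>M) \<le> (\<integral>\<^sup>+ \<omega>. B * ennreal (exp (1 / t * Y \<omega>)) \<partial>N)"
      by (rule mixture[OF _ _ B(3)]) measurable
    then show ?thesis
      using True by (simp add: nn_integral_cmult ennreal_mult_le_mult_iff B dom_gen_top)
  next
    case False
    then obtain a where a: "0 \<le> a" "\<alpha> = ennreal a"
      by (cases \<alpha>) auto
    have "b < a"
      using a b \<open>\<beta> \<le> \<alpha>\<close> \<open>\<beta> \<noteq> \<alpha>\<close> by (auto simp: less_le)
    obtain B where B: "B \<noteq> 0" "B \<noteq> \<top>" "\<And>u. (\<integral>\<^sup>+ s. ennreal (max 0 (s - t) powr (a - b - 1)) * ennreal (max 0 (u - s) powr b) \<partial>lborel)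
        = B * ennreal (max 0 (u - t) powr a)"
      using power_kernel[OF b(1) \<open>b < a\<close>] by blast
    have "(\<integral>\<^sup>+ \<omega>. B * ennreal (max 0 (X \<omega> - t) powr a) \<partial>M) \<le> (\<integral>\<^sup>+ \<omega>. B * ennreal (max 0 (Y \<omega> - t) powr a) \<partial>N)"
      by (rule mixture[OF _ _ B(3)]) measurable
    then show ?thesis
      using a by (simp add: nn_integral_cmult ennreal_mult_le_mult_iff B dom_gen_ennreal)
  qed
qed

text \<open>For \<alpha> > 0 each mean is a positive multiple of the mean of one generator: t = x -
  a / l when \<alpha> = a is finite, and t = 1 / l when \<alpha> = \<infinity>. The mixtures lead
  from order \<gamma> to order \<alpha> + 1.\<close>

lemma tail_bound_mono_stoch_dom:
  assumes M: "prob_space M" "X \<in> borel_measurable M" and N: "prob_space N" "Y \<in> borel_measurable N"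
    and \<gamma>: "1 \<le> \<gamma>" "\<gamma> \<le> \<alpha> + 1" and dom: "stoch_dom \<gamma> M X N Y"
  shows "tail_bound \<alpha> M X x \<le> tail_bound \<alpha> N Y x"
proof (rule tail_bound_mono)
  note [measurable] = M(2) N(2)
  have "\<gamma> - 1 \<le> \<alpha>"
    using \<gamma> by (simp add: ennreal_minus_le_iff add.commute)
  then have le: "(\<integral>\<^sup>+ \<omega>. ennreal (dom_gen \<alpha> t (X \<omega>)) \<partial>M) \<le> (\<integral>\<^sup>+ \<omega>. ennreal (dom_gen \<alpha> t (Y \<omega>)) \<partial>N)"
    if "t \<in> dom_index \<alpha>" for t
    by (rule dom_gen_le_mono[OF M N _ that stoch_dom_gen_le[OF dom]])
  fix l :: real
  assume l: "0 < l"
  show "tail_mean \<alpha> M X x l \<le> tail_mean \<alpha> N Y x l"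
  proof (cases \<alpha> rule: ennreal_param_cases)
    case zero
    \<comment> \<open>Generators of order 1 see u > t, whereas \<open>tail_h 0\<close> sees u \<ge>
      x; the levels x - 1 / (n + 1) increase to x.\<close>
    have lim: "(\<lambda>n. \<integral>\<^sup>+ \<omega>. ennreal (dom_gen 0 (x - 1 / real (Suc n)) (Z \<omega>)) \<partial>L) \<longlonglongrightarrow> tail_mean 0 L Z x l"
      if "prob_space L" and [measurable]: "Z \<in> borel_measurable L" for L :: "'c measure" and Z
    proof -
      interpret L: prob_space L by fact
      show ?thesis
        unfolding tail_mean_def
      proof (rule nn_integral_dominated_convergence[where w = "\<lambda>_. 1"])
        show "(\<lambda>\<omega>. ennreal (dom_gen 0 (x - 1 / real (Suc n)) (Z \<omega>))) \<in> borel_measurable L" for n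
          unfolding dom_gen_def by measurable
        show "AE \<omega> in L. (\<lambda>n. ennreal (dom_gen 0 (x - 1 / real (Suc n)) (Z \<omega>))) \<longlonglongrightarrow> ennreal (tail_h 0 (l * (Z \<omega> - x)))"
        proof (intro AE_I2 tendsto_ennrealI tendsto_eventually)
          fix \<omega>
          show "\<forall>\<^sub>F n in sequentially. dom_gen 0 (x - 1 / real (Suc n)) (Z \<omega>) = tail_h 0 (l * (Z \<omega> - x))"
          proof (cases "x \<le> Z \<omega>")
            case True
            then have "x - 1 / real (Suc n) < Z \<omega>" for n
              using less_le_trans[of "x - 1 / real (Suc n)" x "Z \<omega>"] by simp
            with True l show ?thesis
              by (simp add: dom_gen_def tail_h_0)
          next
            case False
            have "(\<lambda>n. x - 1 / real (Suc n)) \<longlonglongrightarrow> x - 0"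
              by (intro tendsto_intros lim_const_over_n[THEN LIMSEQ_Suc])
            then have "\<forall>\<^sub>F n in sequentially. Z \<omega> < x - 1 / real (Suc n)"
              using False by (intro order_tendstoD) auto
            then show ?thesis
              by eventually_elim (use False l in \<open>auto simp: dom_gen_def tail_h_0 zero_le_mult_iff\<close>)
          qed
        qed
      qed (auto simp: L.emeasure_space_1 dom_gen_def)
    qed
    show ?thesis
      unfolding zero
      by (rule LIMSEQ_le[OF lim[OF M] lim[OF N]]) (use le zero in \<open>auto simp: dom_index_def\<close>)
  next
    case (real a)
    define t where "t = x - a / l"
    have t: "t < x" "l = a / (x - t)"
      using real l by (auto simp: t_def)
    have eq: "tail_mean \<alpha> L Z x l = ennreal (1 / (x - t) powr a) * (\<integral>\<^sup>+ \<omega>. ennreal (dom_gen \<alpha> t (Z \<omega>)) \<partial>L)"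
      if [measurable]: "Z \<in> borel_measurable L" for L :: "'c measure" and Z
    proof -
      have "tail_mean \<alpha> L Z x l = (\<integral>\<^sup>+ \<omega>. ennreal (1 / (x - t) powr a) * ennreal (max 0 (Z \<omega> - t) powr a) \<partial>L)"
        unfolding t(2) real(2) tail_mean_ennreal[OF real(1) t(1)] by (simp flip: ennreal_mult)
      also have "\<dots> = ennreal (1 / (x - t) powr a) * (\<integral>\<^sup>+ \<omega>. ennreal (max 0 (Z \<omega> - t) powr a) \<partial>L)"
        by (rule nn_integral_cmult) measurable
      finally show ?thesis
        using real by (simp add: dom_gen_ennreal)
    qed
    show ?thesis
      unfolding eq[OF M(2)] eq[OF N(2)] using le[of t] real by (intro mult_left_mono) (auto simp: dom_index_def)
  next
    case top
    show ?thesis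
      using le[of "1 / l"] l unfolding top tail_mean_top[OF M(2)] tail_mean_top[OF N(2)]
      by (intro mult_left_mono) (auto simp: dom_index_def dom_gen_top mult.commute)
  qed
qed

subsection \<open>Convergence in distribution\<close>

lemma weak_conv_representation:
  assumes M: "prob_space M" and X: "X \<in> borel_measurable M"
    and N: "\<And>n. prob_space (N n)" and Y: "\<And>n. Y n \<in> borel_measurable (N n)"
    and conv: "weak_conv_m (\<lambda>n. distr (N n) borel (Y n)) (distr M borel X)"
  obtains \<Omega> :: "real measure" and Y' X' where "prob_space \<Omega>"
    "\<And>n. Y' n \<in> borel_measurable \<Omega>" "\<And>n. distr \<Omega> borel (Y' n) = distr (N n) borel (Y n)"
    "X' \<in> borel_measurable \<Omega>" "distr \<Omega> borel X' = distr M borel X"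
    "\<And>\<omega>. \<omega> \<in> space \<Omega> \<Longrightarrow> (\<lambda>n. Y' n \<omega>) \<longlonglongrightarrow> X' \<omega>"
  using Skorohod[OF _ _ conv] prob_space.real_distribution_distr[OF N Y] prob_space.real_distribution_distr[OF M X]
  by (metis measurable_lborel1)

text \<open>
  Truncation of \<open>Y n\<close> at \<open>K\<close> leaves a bounded continuous function, and uniform integrability
  controls the rest uniformly in \<open>n\<close>.
\<close>

lemma limsup_tail_mean_le:
  assumes M: "prob_space M" and X [measurable]: "X \<in> borel_measurable M"
    and N: "\<And>n. prob_space (N n)" and Y [measurable]: "\<And>n. Y n \<in> borel_measurable (N n)"
    and conv: "weak_conv_m (\<lambda>n. distr (N n) borel (Y n)) (distr M borel X)"
    and ui: "tail_unif_integrable \<alpha> M X N Y" and "0 < \<alpha>" and l: "0 < l" and fin: "tail_mean \<alpha> M X x l < \<infinity>"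
  shows "limsup (\<lambda>n. tail_mean \<alpha> (N n) (Y n) x l) \<le> tail_mean \<alpha> M X x l"
proof -
  define h where "h u = tail_h \<alpha> (l * (u - x))" for u
  have [measurable]: "h \<in> borel_measurable borel"
    unfolding h_def by measurable
  have h_mono: "u \<le> v \<Longrightarrow> h u \<le> h v" for u v
    unfolding h_def using l by (intro tail_h_mono mult_left_mono) auto
  \<comment> \<open>\<phi> is the function in the uniform integrability condition, max 0 u powr a or
    exp (l * u). Beyond 1 it dominates h up to the constant C.\<close>
  obtain \<phi> C where \<phi> [measurable]: "\<phi> \<in> borel_measurable borel" and "0 \<le> C"
    and h_le: "\<And>u. 1 \<le> u \<Longrightarrow> h u \<le> C * \<phi> u" and \<phi>_nonneg: "\<And>u. 0 \<le> \<phi> u"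
    and tails: "((\<lambda>K. SUP n. \<integral>\<^sup>+ \<omega>. ennreal (\<phi> (Y n \<omega>)) * indicator {\<omega>. Y n \<omega> > K} \<omega> \<partial>N n) \<longlongrightarrow> 0) at_top"
  proof (cases \<alpha> rule: ennreal_param_cases)
    case zero
    with \<open>0 < \<alpha>\<close> show ?thesis by simp
  next
    case (real a)
    obtain C where C: "0 \<le> C" "\<And>u. 1 \<le> u \<Longrightarrow> tail_h (ennreal a) (l * (u - x)) \<le> C * u powr a"
      by (rule tail_h_le_powr[OF real(1) l, of x]) blast
    show ?thesis
      using C real ui by (intro that[of "\<lambda>u. max 0 u powr a" C]) (auto simp: h_def tail_unif_integrable_def)
  next
    case top
    \<comment> \<open>Uniform integrability is assumed only at l in \<open>exp_moments M X\<close>,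
      and finiteness of the mean puts l there.\<close>
    have "l \<in> exp_moments M X"
      using fin l top by (auto simp: exp_moments_def tail_mean_top ennreal_mult_less_top ennreal_eq_0_iff not_le)
    then show ?thesis
      using top ui by (intro that[of "\<lambda>u. exp (l * u)" "exp (- l * x)"])
        (auto simp: h_def tail_unif_integrable_def tail_h_top algebra_simps simp flip: exp_add)
  qed
  define S where "S K = (SUP n. \<integral>\<^sup>+ \<omega>. ennreal (\<phi> (Y n \<omega>)) * indicator {\<omega>. Y n \<omega> > K} \<omega> \<partial>N n)" for K
  obtain \<Omega> :: "real measure" and Y' X' where \<Omega>: "prob_space \<Omega>"
    and Y': "\<And>n. Y' n \<in> borel_measurable \<Omega>" "\<And>n. distr \<Omega> borel (Y' n) = distr (N n) borel (Y n)"
    and X': "X' \<in> borel_measurable \<Omega>" "distr \<Omega> borel X' = distr M borel X"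
    and lim: "\<And>\<omega>. \<omega> \<in> space \<Omega> \<Longrightarrow> (\<lambda>n. Y' n \<omega>) \<longlonglongrightarrow> X' \<omega>"
    by (rule weak_conv_representation[OF M X N Y conv]) blast
  interpret \<Omega>: prob_space \<Omega> by fact
  note [measurable] = Y'(1) X'(1)
  \<comment> \<open>K \<ge> 1 places the part cut off where h \<le> C * \<phi>, so the error is at
    most C * S K for all n.\<close>
  have le: "limsup (\<lambda>n. tail_mean \<alpha> (N n) (Y n) x l) \<le> tail_mean \<alpha> M X x l + ennreal C * S K" if K: "1 \<le> K" for K
  proof -
    have "tail_mean \<alpha> (N n) (Y n) x l \<le> (\<integral>\<^sup>+ \<omega>. ennreal (h (min (Y' n \<omega>) K)) \<partial>\<Omega>) + ennreal C * S K" for n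
    proof -
      have ind: "indicator {\<omega>. Y n \<omega> > K} \<omega> = (indicator {K<..} (Y n \<omega>) :: ennreal)" for \<omega>
        by (simp add: indicator_def)
      have "tail_mean \<alpha> (N n) (Y n) x l
          \<le> (\<integral>\<^sup>+ \<omega>. ennreal (h (min (Y n \<omega>) K)) + ennreal C * (ennreal (\<phi> (Y n \<omega>)) * indicator {\<omega>. Y n \<omega> > K} \<omega>) \<partial>N n)"
        unfolding tail_mean_def
      proof (rule nn_integral_mono)
        fix \<omega>
        have "ennreal (h u) \<le> ennreal (h (min u K)) + ennreal C * (ennreal (\<phi> u) * indicator {K<..} u)" for u
        proof (cases "K < u")
          case True
          then have "ennreal (h u) \<le> ennreal C * ennreal (\<phi> u)"
            using h_le[of u] K \<open>0 \<le> C\<close> by (simp add: ennreal_leI flip: ennreal_mult')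
          with True show ?thesis
            by (simp add: add_increasing)
        qed (simp add: min_def not_less)
        then show "ennreal (tail_h \<alpha> (l * (Y n \<omega> - x)))
            \<le> ennreal (h (min (Y n \<omega>) K)) + ennreal C * (ennreal (\<phi> (Y n \<omega>)) * indicator {\<omega>. Y n \<omega> > K} \<omega>)"
          unfolding ind by (simp add: h_def)
      qed
      also have "\<dots> = (\<integral>\<^sup>+ \<omega>. ennreal (h (min (Y n \<omega>) K)) \<partial>N n)
          + ennreal C * (\<integral>\<^sup>+ \<omega>. ennreal (\<phi> (Y n \<omega>)) * indicator {\<omega>. Y n \<omega> > K} \<omega> \<partial>N n)"
        unfolding ind by (subst nn_integral_add) (auto simp: nn_integral_cmult)
      also have "(\<integral>\<^sup>+ \<omega>. ennreal (h (min (Y n \<omega>) K)) \<partial>N n) = (\<integral>\<^sup>+ u. ennreal (h (min u K)) \<partial>distr (N n) borel (Y n))"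
        by (subst nn_integral_distr) auto
      also have "\<dots> = (\<integral>\<^sup>+ \<omega>. ennreal (h (min (Y' n \<omega>) K)) \<partial>\<Omega>)"
        unfolding Y'(2)[symmetric] by (subst nn_integral_distr) auto
      also have "(\<integral>\<^sup>+ \<omega>. ennreal (\<phi> (Y n \<omega>)) * indicator {\<omega>. Y n \<omega> > K} \<omega> \<partial>N n) \<le> S K"
        unfolding S_def by (rule SUP_upper) simp
      finally show ?thesis
        by (simp add: add_left_mono mult_left_mono)
    qed
    then have "limsup (\<lambda>n. tail_mean \<alpha> (N n) (Y n) x l)
        \<le> limsup (\<lambda>n. (\<integral>\<^sup>+ \<omega>. ennreal (h (min (Y' n \<omega>) K)) \<partial>\<Omega>) + ennreal C * S K)"
      by (intro Limsup_mono always_eventually) auto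
    also have "\<dots> = (\<integral>\<^sup>+ \<omega>. ennreal (h (min (X' \<omega>) K)) \<partial>\<Omega>) + ennreal C * S K"
    proof (rule lim_imp_Limsup[OF sequentially_bot], rule tendsto_add[OF _ tendsto_const],
        rule nn_integral_dominated_convergence[where w = "\<lambda>_. ennreal (h K)"])
      show "AE \<omega> in \<Omega>. ennreal (h (min (Y' n \<omega>) K)) \<le> ennreal (h K)" for n
        by (intro AE_I2 ennreal_leI h_mono) simp
      show "AE \<omega> in \<Omega>. (\<lambda>n. ennreal (h (min (Y' n \<omega>) K))) \<longlonglongrightarrow> ennreal (h (min (X' \<omega>) K))"
        unfolding h_def using \<open>0 < \<alpha>\<close>
        by (intro AE_I2 tendsto_ennrealI tail_h_tendsto tendsto_intros lim) auto
    qed (auto simp: \<Omega>.emeasure_space_1 less_top[symmetric] ennreal_mult_eq_top_iff)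
    \<comment> \<open>Since h is nondecreasing, dropping the truncation only enlarges the
      mean.\<close>
    also have "(\<integral>\<^sup>+ \<omega>. ennreal (h (min (X' \<omega>) K)) \<partial>\<Omega>) \<le> (\<integral>\<^sup>+ \<omega>. ennreal (h (X' \<omega>)) \<partial>\<Omega>)"
      by (intro nn_integral_mono ennreal_leI h_mono) simp
    also have "\<dots> = (\<integral>\<^sup>+ u. ennreal (h u) \<partial>distr M borel X)"
      unfolding X'(2)[symmetric] by (subst nn_integral_distr) auto
    also have "\<dots> = tail_mean \<alpha> M X x l"
      by (subst tail_mean_distr) (auto simp: h_def)
    finally show ?thesis
      by (simp add: add_right_mono)
  qed
  have "((\<lambda>K. tail_mean \<alpha> M X x l + ennreal C * S K) \<longlongrightarrow> tail_mean \<alpha> M X x l + ennreal C * 0) at_top"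
    using tails unfolding S_def by (intro tendsto_add tendsto_const ennreal_tendsto_cmult) auto
  then have "limsup (\<lambda>n. tail_mean \<alpha> (N n) (Y n) x l) \<le> tail_mean \<alpha> M X x l + ennreal C * 0"
    by (rule tendsto_lowerbound) (auto intro!: eventually_mono[OF eventually_ge_at_top[of 1]] le)
  then show ?thesis by simp
qed

text \<open>\<open>no_atom\<close> enters the lower half: if X \<le> x almost surely it makes the
  limit 0. Otherwise X > x has positive probability, which depends on the law alone and so passes to
  the Skorohod copy of X.\<close>

lemma tail_bound_tendsto_rv:
  assumes M: "prob_space M" and X: "X \<in> rv_class \<alpha> M"
    and N: "\<And>n. prob_space (N n)" and Y [measurable]: "\<And>n. Y n \<in> borel_measurable (N n)"
    and conv: "weak_conv_m (\<lambda>n. distr (N n) borel (Y n)) (distr M borel X)"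
    and ui: "tail_unif_integrable \<alpha> M X N Y" and "0 < \<alpha>"
    and no_atom: "\<not> (ereal x = x_star M X \<and> 0 < p_star M X)"
  shows "(\<lambda>n. tail_bound \<alpha> (N n) (Y n) x) \<longlonglongrightarrow> tail_bound \<alpha> M X x"
proof (rule tendsto_of_liminf_limsup)
  note X_meas [measurable] = rv_class_measurable[OF X]
  show "limsup (\<lambda>n. tail_bound \<alpha> (N n) (Y n) x) \<le> tail_bound \<alpha> M X x"
    by (intro limsup_tail_bound_le limsup_tail_mean_le[OF M X_meas N Y conv ui \<open>0 < \<alpha>\<close>])
  show "tail_bound \<alpha> M X x \<le> liminf (\<lambda>n. tail_bound \<alpha> (N n) (Y n) x)"
  proof (cases "AE \<omega> in M. X \<omega> \<le> x")
    case True
    then show ?thesis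
      using no_atom at_atom_iff[OF M X_meas, of x \<alpha>] by simp
  next
    case False
    obtain \<Omega> :: "real measure" and Y' X' where \<Omega>: "prob_space \<Omega>"
      and Y': "\<And>n. Y' n \<in> borel_measurable \<Omega>" "\<And>n. distr \<Omega> borel (Y' n) = distr (N n) borel (Y n)"
      and X': "X' \<in> borel_measurable \<Omega>" "distr \<Omega> borel X' = distr M borel X"
      and lim: "\<And>\<omega>. \<omega> \<in> space \<Omega> \<Longrightarrow> (\<lambda>n. Y' n \<omega>) \<longlonglongrightarrow> X' \<omega>"
      by (rule weak_conv_representation[OF M X_meas N Y conv]) blast
    note [measurable] = Y'(1) X'(1)
    have eq: "tail_bound \<alpha> M X x = tail_bound \<alpha> \<Omega> X' x"
      by (rule tail_bound_distr_cong) (auto simp: X')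
    have eqs: "tail_bound \<alpha> (N n) (Y n) x = tail_bound \<alpha> \<Omega> (Y' n) x" for n
      by (rule tail_bound_distr_cong) (auto simp: Y')
    have "(AE \<omega> in \<Omega>. X' \<omega> \<le> x) \<longleftrightarrow> (AE u in distr M borel X. u \<le> x)"
      unfolding X'(2)[symmetric] by (subst AE_distr_iff) auto
    also have "\<dots> \<longleftrightarrow> (AE \<omega> in M. X \<omega> \<le> x)"
      by (subst AE_distr_iff) auto
    finally have "(AE \<omega> in \<Omega>. X' \<omega> \<le> x) \<longleftrightarrow> (AE \<omega> in M. X \<omega> \<le> x)" .
    with False have "\<not> (AE \<omega> in \<Omega>. X' \<omega> \<le> x)" by simp
    then show ?thesis
      unfolding eq eqs using \<open>0 < \<alpha>\<close> tail_bound_le_1[OF M X, of x]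
      by (intro tail_bound_le_liminf[OF \<Omega> X'(1) Y'(1)]) (auto simp: eq lim intro!: AE_I2)
  qed
qed

theorem theorem1p6:
  fixes \<alpha> :: ennreal and x :: real and M :: "'a measure" and X :: "'a \<Rightarrow> real"
  assumes "prob_space M" and "X \<in> rv_class \<alpha> M"
  shows
    \<comment> \<open>Model-independence\<close>
    "(\<forall>(N :: 'b measure) Y. prob_space N \<and> Y \<in> borel_measurable N
        \<and> distr N borel Y = distr M borel X
        \<longrightarrow> tail_bound \<alpha> N Y x = tail_bound \<alpha> M X x)
    \<and>
    \<comment> \<open>Monotonicity in X\<close>
     (\<forall>(N :: 'b measure) Y. prob_space N \<and> Y \<in> rv_class \<alpha> N \<and> stoch_dom (\<alpha> + 1) M X N Y
        \<longrightarrow> tail_bound \<alpha> M X x \<le> tail_bound \<alpha> N Y x)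
    \<and>
     (\<forall>\<gamma> (N :: 'b measure) Y. 1 \<le> \<gamma> \<and> \<gamma> \<le> \<alpha> + 1 \<and> prob_space N \<and> Y \<in> rv_class \<alpha> N
        \<and> stoch_dom \<gamma> M X N Y
        \<longrightarrow> tail_bound \<alpha> M X x \<le> tail_bound \<alpha> N Y x)
    \<and>
     (\<forall>Y. Y \<in> rv_class \<alpha> M \<and> (AE \<omega> in M. X \<omega> \<le> Y \<omega>)
        \<longrightarrow> tail_bound \<alpha> M X x \<le> tail_bound \<alpha> M Y x)
    \<and>
    \<comment> \<open>Monotonicity in alpha; the class shrinks as the parameter grows\<close>
     (\<forall>\<beta> \<gamma>. \<beta> \<le> \<gamma> \<and> X \<in> rv_class \<gamma> M
        \<longrightarrow> tail_bound \<beta> M X x \<le> tail_bound \<gamma> M X x)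
    \<and>
    \<comment> \<open>Monotonicity in x\<close>
     antimono (\<lambda>y. tail_bound \<alpha> M X y)
    \<and>
    \<comment> \<open>Values\<close>
     tail_bound \<alpha> M X x \<in> {0..1}
    \<and>
    \<comment> \<open>Alpha-concavity in x\<close>
     (0 < \<alpha> \<and> \<alpha> < \<infinity> \<longrightarrow> ereal_convex (\<lambda>y. neg_power (tail_bound \<alpha> M X y) (1 / enn2real \<alpha>)))
    \<and>
     (\<alpha> = \<infinity> \<longrightarrow> ereal_concave (\<lambda>y. ext_ln (tail_bound \<alpha> M X y)))
    \<and>
    \<comment> \<open>Stability in x; it fails for alpha = 0 (tail function of a non-degenerate discrete X)\<close>
     (0 < \<alpha> \<longrightarrow>
        (\<forall>y. isCont (\<lambda>z. tail_bound \<alpha> M X z) y \<longleftrightarrow> \<not> (ereal y = x_star M X \<and> 0 < p_star M X)))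
    \<and>
    \<comment> \<open>Stability in alpha\<close>
     (\<forall>a :: nat \<Rightarrow> ennreal. (\<forall>n. a n < \<infinity>) \<and> a \<longlonglongrightarrow> \<alpha> \<and> X \<in> rv_class (SUP n. a n) M
        \<longrightarrow> (\<lambda>n. tail_bound (a n) M X x) \<longlonglongrightarrow> tail_bound \<alpha> M X x)
    \<and>
    \<comment> \<open>Stability in X; it fails at an atom x = sup supp X (X n = x - 1/(n+1), X = x)\<close>
     (\<forall>(N :: nat \<Rightarrow> 'b measure) Y. 0 < \<alpha>
        \<and> (\<forall>n. prob_space (N n) \<and> Y n \<in> borel_measurable (N n))
        \<and> weak_conv_m (\<lambda>n. distr (N n) borel (Y n)) (distr M borel X)
        \<and> tail_unif_integrable \<alpha> M X N Y
        \<and> \<not> (ereal x = x_star M X \<and> 0 < p_star M X)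
        \<longrightarrow> (\<lambda>n. tail_bound \<alpha> (N n) (Y n) x) \<longlonglongrightarrow> tail_bound \<alpha> M X x)
    \<and>
    \<comment> \<open>Translation invariance\<close>
     (\<forall>c. tail_bound \<alpha> M (\<lambda>\<omega>. X \<omega> + c) (x + c) = tail_bound \<alpha> M X x)
    \<and>
    \<comment> \<open>Consistency\<close>
     (\<forall>c. tail_bound \<alpha> M (\<lambda>_. c) x = tail_bound 0 M (\<lambda>_. c) x
        \<and> tail_bound 0 M (\<lambda>_. c) x = (if c \<ge> x then 1 else 0)
        \<and> tail_bound 0 M (\<lambda>_. c) x = emeasure M {\<omega> \<in> space M. c \<ge> x})
    \<and>
    \<comment> \<open>Positive homogeneity\<close>
     (\<forall>\<kappa>>0. tail_bound \<alpha> M (\<lambda>\<omega>. \<kappa> * X \<omega>) (\<kappa> * x) = tail_bound \<alpha> M X x)"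
proof (intro conjI allI impI)
  note M = assms(1) and X = assms(2)
  note X_meas = rv_class_measurable[OF X]
  fix N :: "'b measure" and Y and \<gamma>
  show "tail_bound \<alpha> N Y x = tail_bound \<alpha> M X x"
    if "prob_space N \<and> Y \<in> borel_measurable N \<and> distr N borel Y = distr M borel X"
    using that X_meas by (intro tail_bound_distr_cong) auto
  show "tail_bound \<alpha> M X x \<le> tail_bound \<alpha> N Y x"
    if "prob_space N \<and> Y \<in> rv_class \<alpha> N \<and> stoch_dom (\<alpha> + 1) M X N Y"
    using that by (intro tail_bound_mono_stoch_dom[OF M X_meas, of N Y "\<alpha> + 1"]) (auto dest: rv_class_measurable)
  show "tail_bound \<alpha> M X x \<le> tail_bound \<alpha> N Y x"
    if "1 \<le> \<gamma> \<and> \<gamma> \<le> \<alpha> + 1 \<and> prob_space N \<and> Y \<in> rv_class \<alpha> N \<and> stoch_dom \<gamma> M X N Y"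
    using that by (intro tail_bound_mono_stoch_dom[OF M X_meas, of N Y \<gamma>]) (auto dest: rv_class_measurable)
next
  fix Y
  assume "Y \<in> rv_class \<alpha> M \<and> (AE \<omega> in M. X \<omega> \<le> Y \<omega>)"
  then show "tail_bound \<alpha> M X x \<le> tail_bound \<alpha> M Y x"
    by (intro tail_bound_mono_AE) auto
next
  fix \<beta> \<gamma>
  assume "\<beta> \<le> \<gamma> \<and> X \<in> rv_class \<gamma> M"
  then show "tail_bound \<beta> M X x \<le> tail_bound \<gamma> M X x"
    by (intro tail_bound_mono_param) auto
next
  show "antimono (\<lambda>y. tail_bound \<alpha> M X y)"
    by (rule tail_bound_antimono)
  show "tail_bound \<alpha> M X x \<in> {0..1}"
    using tail_bound_le_1[OF assms] by simp
next
  assume "0 < \<alpha> \<and> \<alpha> < \<infinity>"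
  then show "ereal_convex (\<lambda>y. neg_power (tail_bound \<alpha> M X y) (1 / enn2real \<alpha>))"
    using assms neg_power_tail_bound_convex[of M X "enn2real \<alpha>"] by (simp add: enn2real_positive_iff)
next
  assume "\<alpha> = \<infinity>"
  then show "ereal_concave (\<lambda>y. ext_ln (tail_bound \<alpha> M X y))"
    using assms ext_ln_tail_bound_concave by simp
next
  fix y
  assume "0 < \<alpha>"
  then show "isCont (\<lambda>z. tail_bound \<alpha> M X z) y \<longleftrightarrow> \<not> (ereal y = x_star M X \<and> 0 < p_star M X)"
    by (rule isCont_tail_bound_iff[OF assms])
next
  fix a :: "nat \<Rightarrow> ennreal"
  assume "(\<forall>n. a n < \<infinity>) \<and> a \<longlonglongrightarrow> \<alpha> \<and> X \<in> rv_class (SUP n. a n) M"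
  then show "(\<lambda>n. tail_bound (a n) M X x) \<longlonglongrightarrow> tail_bound \<alpha> M X x"
    by (intro tail_bound_tendsto_param[OF assms _ _ refl]) auto
next
  fix N :: "nat \<Rightarrow> 'b measure" and Y
  assume "0 < \<alpha>
        \<and> (\<forall>n. prob_space (N n) \<and> Y n \<in> borel_measurable (N n))
        \<and> weak_conv_m (\<lambda>n. distr (N n) borel (Y n)) (distr M borel X)
        \<and> tail_unif_integrable \<alpha> M X N Y
        \<and> \<not> (ereal x = x_star M X \<and> 0 < p_star M X)"
  then show "(\<lambda>n. tail_bound \<alpha> (N n) (Y n) x) \<longlonglongrightarrow> tail_bound \<alpha> M X x"
    by (intro tail_bound_tendsto_rv[OF assms]) auto
next
  fix c
  show "tail_bound \<alpha> M (\<lambda>\<omega>. X \<omega> + c) (x + c) = tail_bound \<alpha> M X x"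
    by (rule tail_bound_translate)
  show "tail_bound \<alpha> M (\<lambda>_. c) x = tail_bound 0 M (\<lambda>_. c) x"
    "tail_bound 0 M (\<lambda>_. c) x = (if c \<ge> x then 1 else 0)"
    by (simp_all add: tail_bound_const[OF assms(1)])
  show "tail_bound 0 M (\<lambda>_. c) x = emeasure M {\<omega> \<in> space M. c \<ge> x}"
    by (simp add: tail_bound_0)
next
  fix \<kappa> :: real
  assume "0 < \<kappa>"
  then show "tail_bound \<alpha> M (\<lambda>\<omega>. \<kappa> * X \<omega>) (\<kappa> * x) = tail_bound \<alpha> M X x"
    by (rule tail_bound_scale)
qed

end
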